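(* There exist constants $\epsilon,c>0$, an infinite set $\mathcal{I}$ of positive integers, and a family $\{H_n\}_{n\in\mathcal{I}}$ of $\mathbb{Z}_2$-symmetric local Hamiltonians, where $H_n$ acts on $n$ qubits, such that $H_n$ has ground state energy (smallest eigenvalue) $0$ for every $n\in\mathcal{I}$, while $$\langle\varphi|U^\dagger H_n U|\varphi\rangle>\epsilon n$$ for every $\mathbb{Z}_2$-symmetric depth-$d$ circuit $U$ on $n$ qubits composed of two-qubit gates, every $\mathbb{Z}_2$-symmetric product state $\varphi$ of $n$ qubits, and every $n\in\mathcal{I}$ with $n\ge 2^{cd}$.
   Context: The Hilbert space of $n$ qubits is $(\mathbb{C}^2)^{\otimes n}$, and $X$ is the single-qubit Pauli-$X$ operator. A family $\{H_n\}_{n\in\mathcal{I}}$ (with $\mathcal{I}$ an infinite set of system sizes) is a family of local Hamiltonians if each $H_n$ is a sum of Hermitian interaction terms such that each term acts non-trivially on $O(1)$ qubits, each term has operator norm $O(1)$, and each qubit is involved in $O(1)$ terms, with the constants independent of $n$. No geometric locality is required. A local Hamiltonian is $\mathbb{Z}_2$-symmetric if all its interaction terms commute with $X^{\otimes n}$. A depth-$d$ circuit composed of two-qubit gates is a unitary that is a product of $d$ layers, each layer being a product of two-qubit unitary gates acting on pairwise disjoint pairs of qubits (any pairs of qubits are allowed). A circuit $U$ is $\mathbb{Z}_2$-symmetric if $UX^{\otimes n}=X^{\otimes n}U$ (the symmetry is not imposed on individual gates). A state $\Psi$ of $n$ qubits (unit vector) is $\mathbb{Z}_2$-symmetric if $X^{\otimes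 n}\Psi=\pm\Psi$. A product state is a tensor product of $n$ single-qubit unit vectors. *)

theory Defs
  imports
    Complex_Main
    "Jordan_Normal_Form.Schur_Decomposition"
    "Jordan_Normal_Form.Spectral_Radius"
begin

text \<open>
  The space of \<open>n\<close> qubits is \<^term>\<open>carrier_vec (2 ^ n) :: complex vec set\<close>: the index
  \<open>i < 2 ^ n\<close> is the computational basis state in which qubit \<open>q\<close> (for \<open>q < n\<close>) has the value
  \<^term>\<open>bit i q\<close>. Operators are \<open>2 ^ n \<times> 2 ^ n\<close> complex matrices.
\<close>

definition l2_norm :: "complex vec \<Rightarrow> real" where
  "l2_norm v = sqrt (Re (v \<bullet>c v))"

definition op_norm :: "complex mat \<Rightarrow> real" where
  "op_norm A = (SUP v \<in> {v \<in> carrier_vec (dim_col A). l2_norm v = 1}. l2_norm (A *\<^sub>v v))"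

definition hermitian_mat :: "complex mat \<Rightarrow> bool" where
  "hermitian_mat A \<longleftrightarrow> mat_adjoint A = A"

definition unitary_mat :: "complex mat \<Rightarrow> bool" where
  "unitary_mat U \<longleftrightarrow> inverts_mat U (mat_adjoint U) \<and> inverts_mat (mat_adjoint U) U"

definition sum_mats :: "nat \<Rightarrow> complex mat list \<Rightarrow> complex mat" where
  "sum_mats n As = foldr (+) As (0\<^sub>m (2 ^ n) (2 ^ n))"

definition prod_mats :: "nat \<Rightarrow> complex mat list \<Rightarrow> complex mat" where
  "prod_mats n As = foldr (*) As (1\<^sub>m (2 ^ n))"

definition tensor_vecs :: "nat \<Rightarrow> (nat \<Rightarrow> complex vec) \<Rightarrow> complex vec" where
  "tensor_vecs n v = vec (2 ^ n) (\<lambda>i. \<Prod>q<n. v q $ of_bool (bit i q))"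

definition tensor_power :: "nat \<Rightarrow> complex mat \<Rightarrow> complex mat" where
  "tensor_power n A =
     mat (2 ^ n) (2 ^ n) (\<lambda>(i, j). \<Prod>q<n. A $$ (of_bool (bit i q), of_bool (bit j q)))"

definition pauli_X :: "complex mat" where
  "pauli_X = mat_of_rows_list 2 [[0, 1], [1, 0]]"

text \<open>
  For distinct qubits \<open>qs\<close> and a matrix \<open>G\<close> of dimension \<open>2 ^ length qs\<close>, the operator that acts
  as \<open>G\<close> on \<open>qs\<close> (the \<open>l\<close>-th entry of \<open>qs\<close> being qubit \<open>l\<close> of \<open>G\<close>) and as the identity on the
  other qubits. The \<open>horner_sum\<close> is the number whose \<open>l\<close>-th bit is \<open>bit i (qs ! l)\<close>.
\<close>

definition embed_op :: "nat \<Rightarrow> nat list \<Rightarrow> complex mat \<Rightarrow> complex mat" where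
  "embed_op n qs G = mat (2 ^ n) (2 ^ n) (\<lambda>(i, j).
     if \<forall>q<n. q \<notin> set qs \<longrightarrow> bit i q = bit j q
     then G $$ (horner_sum of_bool 2 (map (bit i) qs), horner_sum of_bool 2 (map (bit j) qs))
     else 0)"

definition acts_trivially_on :: "nat \<Rightarrow> nat \<Rightarrow> complex mat \<Rightarrow> bool" where
  "acts_trivially_on n q A \<longleftrightarrow>
     (\<exists>B \<in> carrier_mat (2 ^ (n - 1)) (2 ^ (n - 1)). A = embed_op n (removeAll q [0..<n]) B)"

definition support_op :: "nat \<Rightarrow> complex mat \<Rightarrow> nat set" where
  "support_op n A = {q. q < n \<and> \<not> acts_trivially_on n q A}"

text \<open>
  A Hamiltonian is given by the list of its interaction terms (\<open>T n\<close> for system size \<open>n\<close>);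
  the operator itself is \<^term>\<open>sum_mats n (T n)\<close>. The constants \<open>k\<close>, \<open>J\<close>, \<open>m\<close> do not depend on \<open>n\<close>.
\<close>

definition local_hamiltonian_family :: "nat set \<Rightarrow> (nat \<Rightarrow> complex mat list) \<Rightarrow> bool" where
  "local_hamiltonian_family I T \<longleftrightarrow>
     (\<exists>(k::nat) (J::real) (m::nat). \<forall>n\<in>I.
        (\<forall>A \<in> set (T n). A \<in> carrier_mat (2 ^ n) (2 ^ n) \<and> hermitian_mat A \<and>
           card (support_op n A) \<le> k \<and> op_norm A \<le> J) \<and>
        (\<forall>q<n. length (filter (\<lambda>A. q \<in> support_op n A) (T n)) \<le> m))"

definition Z2_symmetric_op :: "nat \<Rightarrow> complex mat \<Rightarrow> bool" where
  "Z2_symmetric_op n U \<longleftrightarrow> U * tensor_power n pauli_X = tensor_power n pauli_X * U"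

definition Z2_symmetric_hamiltonian :: "nat \<Rightarrow> complex mat list \<Rightarrow> bool" where
  "Z2_symmetric_hamiltonian n Ts \<longleftrightarrow>
     (\<forall>A \<in> set Ts. Z2_symmetric_op n A)"

text \<open>Meant for Hermitian \<open>H\<close>, whose eigenvalues are real.\<close>

definition ground_state_energy :: "complex mat \<Rightarrow> real" where
  "ground_state_energy H = Min (Re ` spectrum H)"

text \<open>A gate \<open>(a, b, G)\<close> is the two-qubit unitary \<open>G\<close> applied to the qubits \<open>a\<close> and \<open>b\<close>.\<close>

definition is_layer :: "nat \<Rightarrow> complex mat \<Rightarrow> bool" where
  "is_layer n L \<longleftrightarrow>
     (\<exists>gs :: (nat \<times> nat \<times> complex mat) list.
        (\<forall>(a, b, G) \<in> set gs. a < n \<and> b < n \<and> G \<in> carrier_mat 4 4 \<and> unitary_mat G) \<and>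
        distinct (concat (map (\<lambda>(a, b, G). [a, b]) gs)) \<and>
        L = prod_mats n (map (\<lambda>(a, b, G). embed_op n [a, b] G) gs))"

definition is_circuit :: "nat \<Rightarrow> nat \<Rightarrow> complex mat \<Rightarrow> bool" where
  "is_circuit n d U \<longleftrightarrow>
     (\<exists>Ls. length Ls = d \<and> (\<forall>L \<in> set Ls. is_layer n L) \<and> U = prod_mats n Ls)"

definition is_product_state :: "nat \<Rightarrow> complex vec \<Rightarrow> bool" where
  "is_product_state n \<phi> \<longleftrightarrow>
     (\<exists>v. (\<forall>q<n. v q \<in> carrier_vec 2 \<and> l2_norm (v q) = 1) \<and> \<phi> = tensor_vecs n v)"

definition Z2_symmetric_state :: "nat \<Rightarrow> complex vec \<Rightarrow> bool" where
  "Z2_symmetric_state n \<psi> \<longleftrightarrow>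
     tensor_power n pauli_X *\<^sub>v \<psi> = \<psi> \<or> tensor_power n pauli_X *\<^sub>v \<psi> = - \<psi>"

text \<open>
  The expectation value of \<open>A\<close> in the state \<open>\<psi>\<close> (\<open>\<bullet>c\<close> conjugates its right argument);
  for Hermitian \<open>A\<close> the inner product is real.
\<close>

definition expectation :: "complex mat \<Rightarrow> complex vec \<Rightarrow> real" where
  "expectation A \<psi> = Re ((A *\<^sub>v \<psi>) \<bullet>c \<psi>)"

end

theory Submission
  imports Defs "HOL-Combinatorics.Permutations"
begin

text \<open>
  \<open>H\<^sub>n\<close> is the ferromagnetic Ising model on a bounded-degree expander, with a term \<open>1 - Z\<^sub>u Z\<^sub>v\<close> for
  every edge \<open>(u, v)\<close>; the edges come from \<open>15\<close> permutations, which a union bound shows to be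
  expanding for some choice. By expansion, a basis state with magnetization \<open>M = \<Sum>\<^sub>u Z\<^sub>u\<close> has
  energy at least \<open>(n\<^sup>2 - M\<^sup>2) / (4 n)\<close>. In the output of a symmetric depth-\<open>d\<close> circuit on a symmetric
  product state, every \<open>Z\<^sub>u\<close> has mean \<open>0\<close> since it anticommutes with the symmetry, and \<open>Z\<^sub>u\<close>, \<open>Z\<^sub>v\<close>
  are uncorrelated unless their light cones meet, which for each \<open>u\<close> happens for at most \<open>4\<^sup>d\<close>
  qubits \<open>v\<close>. Hence the expectation of \<open>M\<^sup>2\<close> is at most \<open>4\<^sup>d n\<close>, and the energy is at least
  \<open>(n - 4\<^sup>d) / 4\<close>.
\<close>

section \<open>Expanding families of permutations\<close>

text \<open>The two aligned basis states are product states of energy \<open>0\<close>, and their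
  symmetric superpositions, the cat states, are symmetric and also have energy \<open>0\<close>. So
  neither shallowness nor symmetry alone bounds the energy; what separates the cat states from
  shallow outputs is long-range order. The mean of \<open>M\<close> cannot see it, since it vanishes
  in a cat state too, while \<open>M^2\<close> can. The energy is therefore bounded below through
  \<open>n^2 - M^2\<close> and not through the size of the minority domain: \<open>M^2\<close> is a
  sum of two-point functions, which are what light cones control. Expansion makes this trade
  possible; on a lattice, large domains pay only for their walls, and uncorrelated domains reach
  arbitrarily small energy density. Single gates may break the symmetry, so it cannot be followed
  layer by layer. It is used for the output state as a whole, and the light cones use only that the
  gates of a layer are disjoint. As gates may join any two qubits, a cone is controlled by its
  cardinality alone. Random permutations are a convenient source of graphs: they bound the degree by
  construction, and the image of a fixed set is uniformly distributed.\<close>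

lemma binomial_mult_power_le:
  fixes a n s :: nat
  assumes "a \<le> n"
  shows "(a choose s) * n ^ s \<le> (n choose s) * a ^ s"
proof (induction s)
  case 0
  show ?case by simp
next
  case (Suc s)
  have step: "Suc s * (b choose Suc s) = (b choose s) * (b - s)" for b :: nat
    using binomial_absorption[of s b] binomial_absorb_comp[of b s]
    by (cases b) (auto simp: mult.commute)
  \<comment> \<open>The next factor \<open>(a - s) / (n - s)\<close> of the quotient of the binomial
    coefficients is at most \<open>a / n\<close>. Cleared of denominators, this survives truncated
    subtraction, so \<open>s > a\<close> needs no separate case.\<close>
  have "a * n - s * n \<le> a * n - s * a"
    using assms by (intro diff_le_mono2 mult_le_mono2)
  then have "(a - s) * n \<le> (n - s) * a"
    by (simp add: diff_mult_distrib diff_mult_distrib2 mult.commute)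
  then have "((a choose s) * n ^ s) * ((a - s) * n) \<le> ((n choose s) * a ^ s) * ((n - s) * a)"
    using Suc.IH by (rule mult_le_mono[rotated])
  then have "Suc s * ((a choose Suc s) * n ^ Suc s) \<le> Suc s * ((n choose Suc s) * a ^ Suc s)"
    unfolding mult.assoc[symmetric] step by (simp add: mult_ac)
  then show ?case
    by (simp only: Suc_mult_le_cancel1)
qed

text \<open>The image of \<open>S\<close> under a random permutation is uniform among the subsets of
  its size: composing with a permutation that carries \<open>R\<close> to \<open>R'\<close> injects
  the permutations with image \<open>R\<close> into those with image \<open>R'\<close>. The common
  size \<open>c\<close> of these classes is eliminated with the case \<open>T = A\<close>.\<close>

lemma card_permutes_image_subset:
  assumes "finite A" "S \<subseteq> A" "T \<subseteq> A"
  shows "card {p. p permutes A \<and> p ` S \<subseteq> T} * (card A choose card S)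
       = (card T choose card S) * fact (card A)"
proof -
  define P where "P R = {p. p permutes A \<and> p ` S = R}" for R
  have finS: "finite S" and finT: "finite T" using assms finite_subset by auto
  have fin: "finite (P R)" for R
    unfolding P_def by (rule finite_subset[OF _ finite_permutations[OF assms(1)]]) auto
  have le: "card (P R) \<le> card (P R')"
    if R: "R \<subseteq> A" "R' \<subseteq> A" "card R = card R'" for R R'
  proof -
    have fR: "finite R" "finite R'" using R assms(1) finite_subset by auto
    obtain f where f: "bij_betw f R R'"
      using finite_same_card_bij[OF fR R(3)] by auto
    have "card (A - R) = card (A - R')"
      using R fR by (simp add: card_Diff_subset)
    then obtain g where g: "bij_betw g (A - R) (A - R')"
      using finite_same_card_bij assms(1) by (meson finite_Diff)
    define h where "h x = (if x \<in> R then f x else if x \<in> A then g x else x)" for x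
    have hR: "bij_betw h R R'"
      using f by (rule bij_betw_cong[THEN iffD1, rotated]) (simp add: h_def)
    have hA: "bij_betw h (A - R) (A - R')"
      using g by (rule bij_betw_cong[THEN iffD1, rotated]) (simp add: h_def)
    have "bij_betw h (R \<union> (A - R)) (R' \<union> (A - R'))"
      by (rule bij_betw_combine[OF hR hA]) auto
    then have "bij_betw h A A" using R by (simp add: Un_absorb1)
    then have perm: "h permutes A"
      by (rule bij_imp_permutes) (use R in \<open>auto simp: h_def\<close>)
    have inj: "inj_on (\<lambda>p. h \<circ> p) (P R)"
      by (rule inj_onI) (metis fun.inj_map_strong permutes_inj perm injD)
    have "(\<lambda>p. h \<circ> p) ` P R \<subseteq> P R'"
      using hR perm by (auto simp: P_def permutes_compose bij_betw_def image_comp[symmetric])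
    then show ?thesis using inj fin card_inj_on_le by blast
  qed
  define c where "c = card (P S)"
  have c: "card (P R) = c" if "R \<subseteq> A" "card R = card S" for R
    unfolding c_def using le[of R S] le[of S R] that assms by (metis le_antisym)
  have count: "card {p. p permutes A \<and> p ` S \<subseteq> R} = (card R choose card S) * c"
    if R: "R \<subseteq> A" for R
  proof -
    have fR: "finite R" using R assms(1) finite_subset by auto
    have "{p. p permutes A \<and> p ` S \<subseteq> R} = (\<Union>Q\<in>{Q. Q \<subseteq> R \<and> card Q = card S}. P Q)"
      by (auto simp: P_def) (metis card_image permutes_inj_on)
    also have "card \<dots> = (\<Sum>Q\<in>{Q. Q \<subseteq> R \<and> card Q = card S}. card (P Q))"
      by (rule card_UN_disjoint) (use fR fin in \<open>auto simp: P_def\<close>)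
    also have "\<dots> = (\<Sum>Q\<in>{Q. Q \<subseteq> R \<and> card Q = card S}. c)"
      by (rule sum.cong) (use R c in auto)
    also have "\<dots> = (card R choose card S) * c"
      using n_subsets[OF fR, of "card S"] by simp
    finally show ?thesis .
  qed
  have "{p. p permutes A \<and> p ` S \<subseteq> A} = {p. p permutes A}"
    using assms(2) by (auto simp: permutes_in_image)
  then have "(card A choose card S) * c = fact (card A)"
    using count[of A] card_permutations[OF refl assms(1)] by simp
  then show ?thesis
    unfolding count[OF assms(3)] by (simp add: mult.assoc mult.commute[of c])
qed

text \<open>\<open>card T choose s\<close> is estimated in two ways. The crude
  \<open>2 ^ card T\<close> keeps the full factor \<open>n choose s\<close>, which can absorb the
  number of choices of a set. The ratio \<open>card T / n\<close>, at most \<open>3/4\<close>, gives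
  a decay in \<open>s\<close> that is uniform in \<open>n\<close> and that the first bound lacks for
  \<open>s\<close> near \<open>n / 2\<close>.\<close>

lemma card_permutes_small_image_le:
  fixes n s :: nat and S T :: "nat set"
  assumes "card S = s" "S \<subseteq> {..<n}" "T \<subseteq> {..<n}" "2 * s \<le> n" "2 * card T \<le> 3 * s"
  defines "N \<equiv> card {p. p permutes {..<n} \<and> p ` S \<subseteq> T}"
  shows "real N * real (n choose s) \<le> 4 ^ s * fact n"
    and "real N \<le> (3/4) ^ s * fact n"
proof -
  have eq: "N * (n choose s) = (card T choose s) * fact n"
    using card_permutes_image_subset[of "{..<n}" S T] assms by simp
  have "card T choose s \<le> 2 ^ card T"
    by (rule binomial_le_pow2)
  also have "\<dots> \<le> (2::nat) ^ (2 * s)"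
    using assms by (intro power_increasing) auto
  finally have "card T choose s \<le> 4 ^ s" by (simp add: power_mult)
  then have "N * (n choose s) \<le> 4 ^ s * fact n" unfolding eq by simp
  then show "real N * real (n choose s) \<le> 4 ^ s * fact n"
    by (metis (mono_tags, lifting) of_nat_fact of_nat_le_iff of_nat_mult of_nat_numeral of_nat_power)
  have Tn: "card T \<le> n"
    using assms(3) by (metis card_lessThan card_mono finite_lessThan)
  have pos: "n choose s > 0" using assms(4) by simp
  have "(card T choose s) * 4 ^ s * n ^ s \<le> (n choose s) * (4 * card T) ^ s"
    using binomial_mult_power_le[OF Tn, of s] by (simp add: power_mult_distrib)
  also have "\<dots> \<le> (n choose s) * (3 * n) ^ s"
    using assms by (intro mult_le_mono2 power_mono) auto
  finally have "n ^ s * ((card T choose s) * 4 ^ s) \<le> n ^ s * ((n choose s) * 3 ^ s)"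
    by (simp add: power_mult_distrib mult_ac)
  moreover have "n ^ s > 0"
    using assms(4) by (cases s) auto
  ultimately have "(card T choose s) * 4 ^ s \<le> (n choose s) * 3 ^ s" by (metis mult_le_cancel1)
  then have "(card T choose s) * 4 ^ s * fact n \<le> (n choose s) * 3 ^ s * fact n" by simp
  then have "N * 4 ^ s * (n choose s) \<le> 3 ^ s * fact n * (n choose s)"
  proof -
    have "N * 4 ^ s * (n choose s) = (N * (n choose s)) * 4 ^ s" by (simp only: mult_ac)
    also have "\<dots> = (card T choose s) * 4 ^ s * fact n" unfolding eq by (simp only: mult_ac)
    also have "\<dots> \<le> (n choose s) * 3 ^ s * fact n" by fact
    also have "\<dots> = 3 ^ s * fact n * (n choose s)" by (simp only: mult_ac)
    finally show ?thesis .
  qed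
  then have "N * 4 ^ s \<le> 3 ^ s * fact n" using pos by simp
  then have "real N * 4 ^ s \<le> 3 ^ s * fact n"
    by (metis (mono_tags, lifting) of_nat_fact of_nat_le_iff of_nat_mult of_nat_numeral of_nat_power)
  then show "real N \<le> (3/4) ^ s * fact n"
    by (simp add: power_divide field_simps)
qed

text \<open>Two of the \<open>15\<close> permutations pay, through the first bound of
  \<open>card_permutes_small_image_le\<close>, for the number of choices of \<open>S\<close> and \<open>T\<close>; the other \<open>13\<close> give
  the decay, since \<open>16 * (3/4) ^ 13 < 2/5\<close>.\<close>

lemma card_bad_permutation_lists_le:
  fixes n s :: nat
  assumes s: "0 < s" "2 * s \<le> n"
  shows "real (card (\<Union>S\<in>{S. S \<subseteq> {..<n} \<and> card S = s}. \<Union>T\<in>{T. T \<subseteq> {..<n} \<and> card T = s div 2}.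
      {ps. set ps \<subseteq> {p. p permutes {..<n} \<and> p ` S \<subseteq> S \<union> T} \<and> length ps = 15}))
    \<le> (2/5) ^ s * fact n ^ 15" (is "real (card (\<Union>S\<in>?Ss. \<Union>T\<in>?Ts. ?B S T)) \<le> _")
proof -
  define b where "b = real (n choose s)"
  have fin: "finite ?Ss" "finite ?Ts" by auto
  have cS: "card ?Ss = n choose s" and cT: "card ?Ts = n choose (s div 2)"
    using n_subsets[of "{..<n}"] by auto
  have "card (\<Union>S\<in>?Ss. \<Union>T\<in>?Ts. ?B S T) \<le> (\<Sum>S\<in>?Ss. \<Sum>T\<in>?Ts. card (?B S T))"
    by (rule order.trans[OF card_UN_le sum_mono]) (use fin in \<open>auto intro!: card_UN_le\<close>)
  then have "real (card (\<Union>S\<in>?Ss. \<Union>T\<in>?Ts. ?B S T)) \<le> (\<Sum>S\<in>?Ss. \<Sum>T\<in>?Ts. real (card (?B S T)))"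
    by (metis (mono_tags, lifting) of_nat_le_iff of_nat_sum sum.cong)
  also have "\<dots> \<le> (\<Sum>S\<in>?Ss. \<Sum>T\<in>?Ts. (16 * (3/4) ^ 13) ^ s * fact n ^ 15 / b\<^sup>2)"
  proof (intro sum_mono)
    fix S T assume S: "S \<in> ?Ss" and T: "T \<in> ?Ts"
    define N where "N = card {p. p permutes {..<n} \<and> p ` S \<subseteq> S \<union> T}"
    have "card (S \<union> T) \<le> s + s div 2" using S T card_Un_le[of S T] by auto
    then have "2 * card (S \<union> T) \<le> 3 * s" by linarith
    then have N: "real N * b \<le> 4 ^ s * fact n" "real N \<le> (3/4) ^ s * fact n"
      using card_permutes_small_image_le[of S s n "S \<union> T"] S T s by (auto simp: N_def b_def)
    have bpos: "b > 0" using s by (simp add: b_def)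
    have "real N ^ 15 * b\<^sup>2 = (real N * b)\<^sup>2 * real N ^ 13"
      by (simp add: power_mult_distrib power_add[symmetric] mult_ac)
    also have "\<dots> \<le> (4 ^ s * fact n)\<^sup>2 * ((3/4) ^ s * fact n) ^ 13"
      by (rule mult_mono[OF power_mono[OF N(1)] power_mono[OF N(2)]]) (use bpos in auto)
    also have "\<dots> = ((4\<^sup>2) ^ s * ((3/4) ^ 13) ^ s) * (fact n ^ 2 * fact n ^ 13)"
      by (simp only: power_mult_distrib mult_ac power_mult[symmetric])
    also have "\<dots> = (16 * (3/4) ^ 13) ^ s * fact n ^ 15"
      by (simp only: power_mult_distrib[symmetric] power_add[symmetric]) simp
    finally have "real N ^ 15 \<le> (16 * (3/4) ^ 13) ^ s * fact n ^ 15 / b\<^sup>2"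
      using bpos by (simp add: field_simps)
    moreover have "card (?B S T) = N ^ 15"
      unfolding N_def
      by (rule card_lists_length_eq) (auto intro: finite_subset[OF _ finite_permutations[of "{..<n}"]])
    ultimately show "real (card (?B S T)) \<le> (16 * (3/4) ^ 13) ^ s * fact n ^ 15 / b\<^sup>2" by simp
  qed
  also have "\<dots> = b * real (n choose (s div 2)) * ((16 * (3/4) ^ 13) ^ s * fact n ^ 15 / b\<^sup>2)"
    by (simp add: cS cT b_def)
  also have "\<dots> \<le> b * b * ((16 * (3/4) ^ 13) ^ s * fact n ^ 15 / b\<^sup>2)"
  proof (intro mult_right_mono mult_left_mono)
    show "real (n choose (s div 2)) \<le> b"
      unfolding b_def using binomial_mono[of "s div 2" s n] s by simp
  qed (auto simp: b_def)
  also have "\<dots> = (16 * (3/4) ^ 13) ^ s * fact n ^ 15"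
    using s by (simp add: b_def power2_eq_square)
  also have "\<dots> \<le> (2/5) ^ s * fact n ^ 15"
    by (intro mult_right_mono power_mono) (auto simp: field_simps)
  finally show ?thesis .
qed

text \<open>Vertex expansion with constant \<open>1/2\<close>, counted with forward images only: the
  edges \<open>(u, p u)\<close> that leave \<open>S\<close> are enough for a cut. As the inequality
  is strict, its failure bounds the boundary by \<open>card S div 2\<close>.\<close>

definition expanding :: "nat \<Rightarrow> (nat \<Rightarrow> nat) list \<Rightarrow> bool" where
  "expanding n ps \<longleftrightarrow> (\<forall>p\<in>set ps. p permutes {..<n}) \<and>
     (\<forall>S. S \<subseteq> {..<n} \<longrightarrow> S \<noteq> {} \<longrightarrow> 2 * card S \<le> n \<longrightarrow>
        card S < 2 * card ((\<Union>p\<in>set ps. p ` S) - S))"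

text \<open>A list fails on \<open>S\<close> when every permutation maps \<open>S\<close> into
  \<open>S\<close> enlarged by some \<open>T\<close> of size \<open>card S div 2\<close>. Summed
  over the sizes \<open>s\<close>, the share of failing lists is at most a geometric series of ratio
  \<open>2/5\<close>, hence at most \<open>2/3\<close>. A ratio below \<open>1/2\<close> keeps such
  a series below \<open>1\<close> for every \<open>n\<close>; this fixes \<open>13\<close> decaying
  factors, since \<open>16 * (3/4) ^ 12\<close> exceeds \<open>1/2\<close>.\<close>

lemma expanding_permutations_exist: "\<exists>ps. length ps = 15 \<and> expanding n ps"
proof -
  define L where "L = {ps. set ps \<subseteq> {p. p permutes {..<n}} \<and> length ps = 15}"
  define B where "B s = (\<Union>S\<in>{S. S \<subseteq> {..<n} \<and> card S = s}. \<Union>T\<in>{T. T \<subseteq> {..<n} \<and> card T = s div 2}.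
      {ps. set ps \<subseteq> {p. p permutes {..<n} \<and> p ` S \<subseteq> S \<union> T} \<and> length ps = 15})" for s
  define J where "J = {1..n div 2}"
  have cL: "card L = fact n ^ 15"
    unfolding L_def by (subst card_lists_length_eq) (auto simp: finite_permutations card_permutations[OF refl])
  have finL: "finite L"
    unfolding L_def using finite_lists_length_eq[OF finite_permutations[of "{..<n}"], of 15] by simp
  have BL: "B s \<subseteq> L" for s by (auto simp: B_def L_def)
  have "real (card (\<Union>s\<in>J. B s)) \<le> (\<Sum>s\<in>J. real (card (B s)))"
    by (metis (mono_tags, lifting) J_def card_UN_le finite_atLeastAtMost of_nat_le_iff of_nat_sum sum.cong)
  also have "\<dots> \<le> (\<Sum>s\<in>J. (2/5) ^ s * fact n ^ 15)"
    unfolding B_def J_def by (intro sum_mono card_bad_permutation_lists_le) auto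
  also have "\<dots> = (\<Sum>s=1..n div 2. (2/5) ^ s) * fact n ^ 15"
    by (simp add: sum_distrib_right J_def)
  also have "\<dots> < 1 * fact n ^ 15"
  proof (intro mult_strict_right_mono)
    have gp: "(\<Sum>s=1..m. (2/5::real) ^ s) = 2/3 * (1 - (2/5) ^ m)" for m
    proof (induction m)
    case (Suc m)
    have "(\<Sum>s=1..Suc m. (2/5::real) ^ s) = (\<Sum>s=1..m. (2/5) ^ s) + 2/5 * (2/5) ^ m" by simp
    then show ?case unfolding Suc.IH by (simp add: algebra_simps)
  qed simp
    show "(\<Sum>s=1..n div 2. (2/5::real) ^ s) < 1"
    proof -
      have "(\<Sum>s=1..n div 2. (2/5::real) ^ s) = 2/3 * (1 - (2/5) ^ (n div 2))" by (rule gp)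
      also have "\<dots> \<le> 2/3 * 1" by (intro mult_left_mono) auto
      finally show ?thesis by linarith
    qed
  qed simp
  finally have "card (\<Union>s\<in>J. B s) < card L"
    unfolding cL by (metis mult_1 of_nat_fact of_nat_less_iff of_nat_power)
  then have "\<not> L \<subseteq> (\<Union>s\<in>J. B s)"
    using finL BL by (metis (no_types, lifting) UN_least card_subset_eq less_irrefl subset_antisym)
  then obtain ps where ps: "ps \<in> L" "\<And>s. s \<in> J \<Longrightarrow> ps \<notin> B s" by auto
  show ?thesis
    unfolding expanding_def
  proof (intro exI[of _ ps] conjI allI impI)
    show "length ps = 15" "\<forall>p\<in>set ps. p permutes {..<n}" using ps by (auto simp: L_def)
    fix S assume S: "S \<subseteq> {..<n}" "S \<noteq> {}" "2 * card S \<le> n"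
    have finS: "finite S" using S finite_subset by auto
    define E where "E = (\<Union>p\<in>set ps. p ` S) - S"
    have E: "E \<subseteq> {..<n}"
      using ps(1) S(1) by (auto simp: E_def L_def)
        (metis lessThan_iff mem_Collect_eq permutes_in_image subsetD)
    show "card S < 2 * card ((\<Union>p\<in>set ps. p ` S) - S)"
    proof (rule ccontr)
      assume "\<not> ?thesis"
      then have "card E \<le> card S div 2" by (simp add: E_def)
      moreover have "card S div 2 \<le> card {..<n}" using S(3) by simp
      \<comment> \<open>The boundary is padded to the exact size over which \<open>B\<close>
        ranges.\<close>
      ultimately obtain T where T: "E \<subseteq> T" "T \<subseteq> {..<n}" "card T = card S div 2"
        using exists_subset_between[OF _ _ E finite_lessThan] by blast
      have "ps \<in> {ps. set ps \<subseteq> {p. p permutes {..<n} \<and> p ` S \<subseteq> S \<union> T} \<and> length ps = 15}"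
        using ps(1) T(1) by (auto simp: E_def L_def)
      then have "ps \<in> B (card S)"
        unfolding B_def using S(1) T(2,3) by (intro UN_I[of S] UN_I[of T]) auto
      moreover have "card S \<in> J" using S finS by (auto simp: J_def card_gt_0_iff Suc_le_eq)
      ultimately show False using ps(2) by blast
    qed
  qed
qed

section \<open>Operators on qubits and their supports\<close>

lemma nat_eq_if_bits_eq:
  fixes i j :: nat
  assumes "i < 2 ^ n" "j < 2 ^ n" "\<And>q. q < n \<Longrightarrow> bit i q = bit j q"
  shows "i = j"
proof -
  have "take_bit n i = take_bit n j"
    by (rule bit_eqI) (use assms(3) in \<open>auto simp: bit_take_bit_iff\<close>)
  then show ?thesis using assms(1,2) by (simp add: take_bit_nat_eq_self)
qed

definition nat_of_bits :: "nat \<Rightarrow> (nat \<Rightarrow> bool) \<Rightarrow> nat" where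
  "nat_of_bits n f = horner_sum of_bool 2 (map f [0..<n])"

lemma bit_nat_of_bits: "bit (nat_of_bits n f) q \<longleftrightarrow> q < n \<and> f q"
  by (auto simp: nat_of_bits_def bit_horner_sum_bit_iff)

lemma nat_of_bits_less: "nat_of_bits n f < 2 ^ n"
  using horner_sum_of_bool_2_less[of "map f [0..<n]"] by (simp add: nat_of_bits_def)

lemma bit_flip_bit_nat: "bit (flip_bit q (i::nat)) r \<longleftrightarrow> (if r = q then \<not> bit i q else bit i r)"
  by (auto simp: bit_flip_bit_iff)

lemma flip_bit_less: "q < n \<Longrightarrow> (i::nat) < 2 ^ n \<Longrightarrow> flip_bit q i < 2 ^ n"
  by (metis take_bit_flip_bit_eq take_bit_nat_eq_self_iff not_le)

lemma flip_bit_flip_bit: "flip_bit q (flip_bit q (i::nat)) = i"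
  by (rule bit_eqI) (simp add: bit_flip_bit_nat)

lemma bij_betw_flip_bit: "q < n \<Longrightarrow> bij_betw (flip_bit q) {..<2 ^ n} {..<(2::nat) ^ n}"
  by (rule bij_betw_byWitness[where f' = "flip_bit q"]) (auto simp: flip_bit_flip_bit flip_bit_less)

text \<open>Distributivity: expanding the right side picks one summand per qubit, and the patterns
  of picks are the bit strings of length \<open>n\<close>. Sums over all intermediate basis states
  thereby become products over qubits.\<close>

lemma sum_prod_bits:
  fixes f :: "nat \<Rightarrow> bool \<Rightarrow> 'a::comm_semiring_1"
  shows "(\<Sum>k<(2::nat) ^ n. \<Prod>q<n. f q (bit k q)) = (\<Prod>q<n. f q False + f q True)"
proof (induction n)
  case 0
  show ?case by simp
next
  case (Suc n)
  have hi: "bit (k + 2 ^ n) q = bit k q" if "q < n" for k q :: nat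
    using that bit_take_bit_iff[of n "k + 2 ^ n" q] bit_take_bit_iff[of n k q]
    by (simp add: take_bit_eq_mod)
  have top: "bit (k + 2 ^ n) n" "\<not> bit k n" if "k < 2 ^ n" for k :: nat
    using that by (auto simp: bit_iff_odd)
  have split: "{..<(2::nat) ^ Suc n} = {..<2 ^ n} \<union> (\<lambda>k. k + 2 ^ n) ` {..<2 ^ n}"
    by (auto simp: image_def) (metis add.commute add_less_cancel_left le_Suc_ex lessThan_iff mult_2 not_less)
  have "(\<Sum>k<(2::nat) ^ Suc n. \<Prod>q<Suc n. f q (bit k q))
      = (\<Sum>k<(2::nat) ^ n. \<Prod>q<Suc n. f q (bit k q)) + (\<Sum>k<(2::nat) ^ n. \<Prod>q<Suc n. f q (bit (k + 2 ^ n) q))"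
    unfolding split by (subst sum.union_disjoint) (auto simp: sum.reindex)
  also have "(\<Sum>k<(2::nat) ^ n. \<Prod>q<Suc n. f q (bit k q)) = (\<Sum>k<(2::nat) ^ n. (\<Prod>q<n. f q (bit k q)) * f n False)"
    by (rule sum.cong) (auto simp: top)
  also have "(\<Sum>k<(2::nat) ^ n. \<Prod>q<Suc n. f q (bit (k + 2 ^ n) q)) = (\<Sum>k<(2::nat) ^ n. (\<Prod>q<n. f q (bit k q)) * f n True)"
    by (rule sum.cong) (auto simp: top hi)
  finally show ?case
    by (simp add: sum_distrib_right[symmetric] Suc.IH distrib_left)
qed

section \<open>Entries of products and adjoints, and operators acting on a set of qubits\<close>

lemma mat_adjoint_carrier [simp]: "A \<in> carrier_mat m n \<Longrightarrow> mat_adjoint A \<in> carrier_mat n m"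
  by (auto simp: mat_adjoint_def)

lemma mat_adjoint_index:
  fixes A :: "complex mat"
  assumes "A \<in> carrier_mat m n" "i < n" "j < m"
  shows "mat_adjoint A $$ (i, j) = cnj (A $$ (j, i))"
  using assms by (simp add: mat_adjoint_def mat_of_rows_index)

lemma mult_mat_index:
  assumes "A \<in> carrier_mat m k" "B \<in> carrier_mat k n" "i < m" "j < n"
  shows "(A * B) $$ (i, j) = (\<Sum>l<k. A $$ (i, l) * B $$ (l, j))"
  using assms by (auto simp: scalar_prod_def lessThan_atLeast0)

lemma mult_mat_vec_index:
  assumes "A \<in> carrier_mat m k" "v \<in> carrier_vec k" "i < m"
  shows "(A *\<^sub>v v) $ i = (\<Sum>l<k. A $$ (i, l) * v $ l)"
  using assms by (auto simp: scalar_prod_def lessThan_atLeast0)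

lemma cscalar_prod_sum:
  fixes v w :: "complex vec"
  assumes "v \<in> carrier_vec k" "w \<in> carrier_vec k"
  shows "v \<bullet>c w = (\<Sum>l<k. v $ l * cnj (w $ l))"
  using assms by (auto simp: scalar_prod_def lessThan_atLeast0)

lemma cscalar_prod_mult_mat_vec:
  fixes A :: "complex mat"
  assumes A: "A \<in> carrier_mat m k" and v: "v \<in> carrier_vec k" and w: "w \<in> carrier_vec m"
  shows "(A *\<^sub>v v) \<bullet>c w = v \<bullet>c (mat_adjoint A *\<^sub>v w)"
proof -
  have "(A *\<^sub>v v) \<bullet>c w = (\<Sum>i<m. (\<Sum>l<k. A $$ (i, l) * v $ l) * cnj (w $ i))"
    using A v w by (subst cscalar_prod_sum[of _ m]) (auto simp: mult_mat_vec_index[OF A v] simp del: index_mult_mat_vec intro!: sum.cong)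
  also have "\<dots> = (\<Sum>l<k. \<Sum>i<m. A $$ (i, l) * v $ l * cnj (w $ i))"
    by (subst sum.swap) (simp add: sum_distrib_right)
  also have "\<dots> = (\<Sum>l<k. v $ l * cnj (\<Sum>i<m. mat_adjoint A $$ (l, i) * w $ i))"
    by (rule sum.cong) (auto simp: mat_adjoint_index[OF A] sum_distrib_left mult_ac)
  also have "\<dots> = v \<bullet>c (mat_adjoint A *\<^sub>v w)"
    using mat_adjoint_carrier[OF A] v w
    by (subst cscalar_prod_sum[of _ k]) (auto simp: mult_mat_vec_index simp del: index_mult_mat_vec intro!: sum.cong)
  finally show ?thesis .
qed

lemma mat_adjoint_mult:
  fixes A B :: "complex mat"
  assumes "A \<in> carrier_mat m k" "B \<in> carrier_mat k n"
  shows "mat_adjoint (A * B) = mat_adjoint B * mat_adjoint A"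
proof (rule eq_matI)
  fix i j assume ij: "i < dim_row (mat_adjoint B * mat_adjoint A)" "j < dim_col (mat_adjoint B * mat_adjoint A)"
  have c: "mat_adjoint A \<in> carrier_mat k m" "mat_adjoint B \<in> carrier_mat n k"
    using assms by auto
  have lt: "i < n" "j < m" using ij c by auto
  show "mat_adjoint (A * B) $$ (i, j) = (mat_adjoint B * mat_adjoint A) $$ (i, j)"
    using assms lt
    by (simp add: mat_adjoint_index[of _ m n] mult_mat_index[OF c(2,1)] mult_mat_index[OF assms]
        mat_adjoint_index[OF assms(1)] mat_adjoint_index[OF assms(2)] mult.commute
        del: index_mult_mat)
qed (use assms in \<open>auto simp: mat_adjoint_def\<close>)

lemma unitary_mat_left:
  assumes "unitary_mat U" "U \<in> carrier_mat n n"
  shows "mat_adjoint U * U = 1\<^sub>m n"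
  using assms mat_adjoint_carrier[OF assms(2)] by (simp add: unitary_mat_def inverts_mat_def)

text \<open>The two conditions say that \<open>A\<close> commutes with Pauli \<open>Z\<close> and Pauli \<open>X\<close> on every qubit
  outside \<open>S\<close>.\<close>

definition acts_on :: "nat \<Rightarrow> nat set \<Rightarrow> complex mat \<Rightarrow> bool" where
  "acts_on n S A \<longleftrightarrow> A \<in> carrier_mat (2 ^ n) (2 ^ n) \<and>
     (\<forall>q<n. q \<notin> S \<longrightarrow> (\<forall>i<2 ^ n. \<forall>j<2 ^ n.
        (bit i q \<noteq> bit j q \<longrightarrow> A $$ (i, j) = 0) \<and>
        A $$ (flip_bit q i, flip_bit q j) = A $$ (i, j)))"

lemma acts_on_carrier: "acts_on n S A \<Longrightarrow> A \<in> carrier_mat (2 ^ n) (2 ^ n)"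
  by (simp add: acts_on_def)

lemma acts_on_zero:
  "\<lbrakk>acts_on n S A; q < n; q \<notin> S; i < 2 ^ n; j < 2 ^ n; bit i q \<noteq> bit j q\<rbrakk> \<Longrightarrow> A $$ (i, j) = 0"
  by (simp add: acts_on_def)

lemma acts_on_flip:
  "\<lbrakk>acts_on n S A; q < n; q \<notin> S; i < 2 ^ n; j < 2 ^ n\<rbrakk> \<Longrightarrow> A $$ (flip_bit q i, flip_bit q j) = A $$ (i, j)"
  by (simp add: acts_on_def)

lemma acts_on_mono: "acts_on n S A \<Longrightarrow> S \<subseteq> T \<Longrightarrow> acts_on n T A"
  unfolding acts_on_def by blast

lemma acts_on_mult:
  assumes "acts_on n S A" "acts_on n S B"
  shows "acts_on n S (A * B)"
proof -
  note cA = acts_on_carrier[OF assms(1)] and cB = acts_on_carrier[OF assms(2)]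
  show ?thesis unfolding acts_on_def
  proof (intro conjI allI impI)
    show "A * B \<in> carrier_mat (2 ^ n) (2 ^ n)" using cA cB by simp
    fix q i j assume q: "q < n" "q \<notin> S" and ij: "i < (2::nat) ^ n" "j < (2::nat) ^ n"
    show "(A * B) $$ (i, j) = 0" if "bit i q \<noteq> bit j q"
      unfolding mult_mat_index[OF cA cB ij]
    proof (intro sum.neutral ballI)
      fix k assume "k \<in> {..<(2::nat) ^ n}"
      then show "A $$ (i, k) * B $$ (k, j) = 0"
        using acts_on_zero[OF assms(1) q ij(1), of k] acts_on_zero[OF assms(2) q _ ij(2), of k] that
        by (cases "bit i q = bit k q") auto
    qed
    have "(A * B) $$ (flip_bit q i, flip_bit q j)
        = (\<Sum>k<2 ^ n. A $$ (flip_bit q i, k) * B $$ (k, flip_bit q j))"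
      using ij q by (intro mult_mat_index[OF cA cB]) (auto simp: flip_bit_less)
    also have "\<dots> = (\<Sum>k<2 ^ n. A $$ (flip_bit q i, flip_bit q k) * B $$ (flip_bit q k, flip_bit q j))"
      by (rule sum.reindex_bij_betw[OF bij_betw_flip_bit[OF q(1)], symmetric])
    also have "\<dots> = (\<Sum>k<2 ^ n. A $$ (i, k) * B $$ (k, j))"
      using ij by (intro sum.cong) (auto simp: acts_on_flip[OF assms(1) q] acts_on_flip[OF assms(2) q])
    also have "\<dots> = (A * B) $$ (i, j)"
      by (rule mult_mat_index[OF cA cB ij, symmetric])
    finally show "(A * B) $$ (flip_bit q i, flip_bit q j) = (A * B) $$ (i, j)" .
  qed
qed

lemma acts_on_adjoint:
  assumes "acts_on n S A"
  shows "acts_on n S (mat_adjoint A)"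
  using assms mat_adjoint_carrier[of A "2 ^ n" "2 ^ n"] unfolding acts_on_def
  by (auto simp: mat_adjoint_index[of A "2 ^ n" "2 ^ n"] flip_bit_less)

text \<open>An entry depends only on the bits in \<open>S\<close>, once row and column agree
  elsewhere. The disagreements of \<open>i\<close> and \<open>i'\<close> lie outside
  \<open>S\<close> and are removed one qubit at a time, each by flipping row and column
  together.\<close>

lemma acts_on_cong:
  assumes A: "acts_on n S A"
    and "i < 2 ^ n" "j < 2 ^ n" "i' < 2 ^ n" "j' < 2 ^ n"
    and "\<And>q. q < n \<Longrightarrow> q \<notin> S \<Longrightarrow> bit i q = bit j q \<and> bit i' q = bit j' q"
    and "\<And>q. q < n \<Longrightarrow> q \<in> S \<Longrightarrow> bit i q = bit i' q \<and> bit j q = bit j' q"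
  shows "A $$ (i, j) = A $$ (i', j')"
  using assms(2-)
proof (induction "card {q. q < n \<and> bit i q \<noteq> bit i' q}" arbitrary: i j)
  case 0
  then have *: "bit i q = bit i' q" if "q < n" for q using that by auto
  then have "i = i'" using nat_eq_if_bits_eq 0 by blast
  moreover have "bit j q = bit j' q" if "q < n" for q using that * 0(6,7) by blast
  then have "j = j'" using nat_eq_if_bits_eq 0 by blast
  ultimately show ?case by simp
next
  case (Suc m)
  have "{q. q < n \<and> bit i q \<noteq> bit i' q} \<noteq> {}"
    using Suc.hyps(2) by (metis card.empty nat.distinct(1))
  then obtain q where q: "q < n" "bit i q \<noteq> bit i' q" by blast
  then have qS: "q \<notin> S" using Suc.prems by blast
  have "{r. r < n \<and> bit (flip_bit q i) r \<noteq> bit i' r} = {r. r < n \<and> bit i r \<noteq> bit i' r} - {q}"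
    using q by (auto simp: bit_flip_bit_nat split: if_splits)
  then have "m = card {r. r < n \<and> bit (flip_bit q i) r \<noteq> bit i' r}"
    using Suc.hyps(2) q by simp
  then have "A $$ (flip_bit q i, flip_bit q j) = A $$ (i', j')"
    by (rule Suc.hyps(1)) (use Suc.prems q qS in \<open>auto simp: flip_bit_less bit_flip_bit_nat\<close>)
  then show ?case
    using acts_on_flip[OF A q(1) qS Suc.prems(1,2)] by simp
qed

text \<open>A single intermediate state \<open>k\<close> survives: \<open>A\<close> forces it to
  agree with \<open>i\<close> off \<open>S\<close>, and \<open>B\<close> forces it to agree with
  \<open>j\<close> off \<open>T\<close>, in particular on \<open>S\<close>.\<close>

lemma acts_on_disjoint_mult_index:
  assumes A: "acts_on n S A" and B: "acts_on n T B" and "S \<inter> T = {}"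
    and ij: "i < 2 ^ n" "j < 2 ^ n"
  defines "k \<equiv> nat_of_bits n (\<lambda>q. if q \<in> S then bit j q else bit i q)"
  shows "(A * B) $$ (i, j) = A $$ (i, k) * B $$ (k, j)"
proof -
  have k: "k < 2 ^ n" by (simp add: k_def nat_of_bits_less)
  have "(A * B) $$ (i, j) = (\<Sum>l<2 ^ n. A $$ (i, l) * B $$ (l, j))"
    by (rule mult_mat_index[OF acts_on_carrier[OF A] acts_on_carrier[OF B] ij])
  also have "\<dots> = (\<Sum>l\<in>{k}. A $$ (i, l) * B $$ (l, j))"
  proof (rule sum.mono_neutral_right)
    show "\<forall>l\<in>{..<2 ^ n} - {k}. A $$ (i, l) * B $$ (l, j) = 0"
    proof
      fix l assume l: "l \<in> {..<2 ^ n} - {k}"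
      then obtain q where q: "q < n" "bit l q \<noteq> bit k q"
        using nat_eq_if_bits_eq[of l n k] k by auto
      show "A $$ (i, l) * B $$ (l, j) = 0"
      proof (cases "q \<in> S")
        case True
        then have "q \<notin> T" "bit l q \<noteq> bit j q" using q assms(3) by (auto simp: k_def bit_nat_of_bits)
        then show ?thesis using acts_on_zero[OF B q(1)] l ij by simp
      next
        case False
        then have "bit i q \<noteq> bit l q" using q by (auto simp: k_def bit_nat_of_bits)
        then show ?thesis using acts_on_zero[OF A q(1) False] l ij by simp
      qed
    qed
  qed (use k in auto)
  finally show ?thesis by simp
qed

text \<open>Both products collapse to one term, through the intermediate states \<open>k\<close> and
  \<open>l\<close>. These terms have equal factors, since \<open>A\<close> sees only the bits in
  \<open>S\<close> and \<open>B\<close> only those in \<open>T\<close>. If \<open>i\<close> and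
  \<open>j\<close> differ outside both sets, both entries vanish.\<close>

lemma acts_on_disjoint_commute:
  assumes A: "acts_on n S A" and B: "acts_on n T B" and disj: "S \<inter> T = {}"
  shows "A * B = B * A"
proof (rule eq_matI)
  note cA = acts_on_carrier[OF A] and cB = acts_on_carrier[OF B]
  fix i j assume "i < dim_row (B * A)" "j < dim_col (B * A)"
  then have ij: "i < 2 ^ n" "j < 2 ^ n" using cA cB by auto
  show "(A * B) $$ (i, j) = (B * A) $$ (i, j)"
  proof (cases "\<forall>q<n. q \<notin> S \<union> T \<longrightarrow> bit i q = bit j q")
    case True
    define k where "k = nat_of_bits n (\<lambda>q. if q \<in> S then bit j q else bit i q)"
    define l where "l = nat_of_bits n (\<lambda>q. if q \<in> T then bit j q else bit i q)"
    have kl: "k < 2 ^ n" "l < 2 ^ n" by (simp_all add: k_def l_def nat_of_bits_less)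
    have "A $$ (i, k) = A $$ (l, j)"
      by (rule acts_on_cong[OF A]) (use ij kl True disj in \<open>auto simp: k_def l_def bit_nat_of_bits\<close>)
    moreover have "B $$ (k, j) = B $$ (i, l)"
      by (rule acts_on_cong[OF B]) (use ij kl True disj in \<open>auto simp: k_def l_def bit_nat_of_bits\<close>)
    ultimately show ?thesis
      using acts_on_disjoint_mult_index[OF A B disj ij] acts_on_disjoint_mult_index[OF B A _ ij] disj
      by (simp add: k_def l_def Int_commute)
  next
    case False
    have "acts_on n (S \<union> T) (A * B)" "acts_on n (S \<union> T) (B * A)"
      using acts_on_mono[OF A, of "S \<union> T"] acts_on_mono[OF B, of "S \<union> T"] by (auto intro: acts_on_mult)
    then show ?thesis using False acts_on_zero ij by metis
  qed
qed (use acts_on_carrier[OF A] acts_on_carrier[OF B] in auto)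

section \<open>Product states\<close>

text \<open>The factors are functions of two bits rather than matrices, so that products are formed
  qubit by qubit without dimension conditions.\<close>

definition tensor_mats :: "nat \<Rightarrow> (nat \<Rightarrow> bool \<Rightarrow> bool \<Rightarrow> complex) \<Rightarrow> complex mat" where
  "tensor_mats n M = mat (2 ^ n) (2 ^ n) (\<lambda>(i, j). \<Prod>q<n. M q (bit i q) (bit j q))"

lemma tensor_mats_carrier [simp]: "tensor_mats n M \<in> carrier_mat (2 ^ n) (2 ^ n)"
  by (simp add: tensor_mats_def)

lemma dim_tensor_mats [simp]: "dim_row (tensor_mats n M) = 2 ^ n" "dim_col (tensor_mats n M) = 2 ^ n"
  by (simp_all add: tensor_mats_def)

lemma tensor_mats_index:
  "i < 2 ^ n \<Longrightarrow> j < 2 ^ n \<Longrightarrow> tensor_mats n M $$ (i, j) = (\<Prod>q<n. M q (bit i q) (bit j q))"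
  by (simp add: tensor_mats_def)

lemma tensor_mats_cong:
  assumes "\<And>q a b. q < n \<Longrightarrow> M q a b = N q a b"
  shows "tensor_mats n M = tensor_mats n N"
  unfolding tensor_mats_def using assms by (intro cong_mat) (auto intro!: prod.cong)

lemma tensor_mats_mult:
  "tensor_mats n M * tensor_mats n N
    = tensor_mats n (\<lambda>q a b. M q a False * N q False b + M q a True * N q True b)"
proof (rule eq_matI)
  let ?MN = "tensor_mats n (\<lambda>q a b. M q a False * N q False b + M q a True * N q True b)"
  fix i j assume "i < dim_row ?MN" "j < dim_col ?MN"
  then have ij: "i < 2 ^ n" "j < 2 ^ n" by auto
  have "(tensor_mats n M * tensor_mats n N) $$ (i, j)
      = (\<Sum>k<(2::nat) ^ n. \<Prod>q<n. M q (bit i q) (bit k q) * N q (bit k q) (bit j q))"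
    unfolding mult_mat_index[OF tensor_mats_carrier tensor_mats_carrier ij]
    using ij by (intro sum.cong) (auto simp: tensor_mats_index prod.distrib)
  also have "\<dots> = (\<Prod>q<n. M q (bit i q) False * N q False (bit j q) + M q (bit i q) True * N q True (bit j q))"
    by (rule sum_prod_bits)
  finally show "(tensor_mats n M * tensor_mats n N) $$ (i, j) = ?MN $$ (i, j)"
    using ij by (simp only: tensor_mats_index)
qed auto

lemma tensor_mats_mult_vec:
  "tensor_mats n M *\<^sub>v tensor_vecs n v
    = vec (2 ^ n) (\<lambda>i. \<Prod>q<n. M q (bit i q) False * v q $ 0 + M q (bit i q) True * v q $ 1)"
proof (rule eq_vecI)
  fix i assume "i < dim_vec (vec (2 ^ n) (\<lambda>i. \<Prod>q<n. M q (bit i q) False * v q $ 0 + M q (bit i q) True * v q $ 1))"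
  then have i: "i < 2 ^ n" by simp
  have v: "tensor_vecs n v \<in> carrier_vec (2 ^ n)" by (simp add: tensor_vecs_def)
  have "(tensor_mats n M *\<^sub>v tensor_vecs n v) $ i
      = (\<Sum>k<(2::nat) ^ n. \<Prod>q<n. M q (bit i q) (bit k q) * v q $ of_bool (bit k q))"
    unfolding mult_mat_vec_index[OF tensor_mats_carrier v i]
    using i by (intro sum.cong) (auto simp: tensor_mats_index tensor_vecs_def prod.distrib)
  also have "\<dots> = (\<Prod>q<n. M q (bit i q) False * v q $ 0 + M q (bit i q) True * v q $ 1)"
    using sum_prod_bits[where f = "\<lambda>q c. M q (bit i q) c * v q $ of_bool c"] by simp
  finally show "(tensor_mats n M *\<^sub>v tensor_vecs n v) $ i
      = vec (2 ^ n) (\<lambda>i. \<Prod>q<n. M q (bit i q) False * v q $ 0 + M q (bit i q) True * v q $ 1) $ i"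
    using i by simp
qed simp

lemma acts_on_tensor_mats:
  assumes "\<And>q a b. q < n \<Longrightarrow> q \<notin> R \<Longrightarrow> M q a b = of_bool (a = b)"
  shows "acts_on n R (tensor_mats n M)"
  unfolding acts_on_def
proof (intro conjI allI impI)
  fix q i j assume q: "q < n" "q \<notin> R" and ij: "i < (2::nat) ^ n" "j < (2::nat) ^ n"
  show "tensor_mats n M $$ (i, j) = 0" if "bit i q \<noteq> bit j q"
    using ij q that by (auto simp: tensor_mats_index assms intro!: bexI[of _ q])
  show "tensor_mats n M $$ (flip_bit q i, flip_bit q j) = tensor_mats n M $$ (i, j)"
    using ij q by (auto simp: tensor_mats_index flip_bit_less bit_flip_bit_nat assms intro!: prod.cong)
qed simp

text \<open>For unit vectors \<open>v q\<close> this is the projector \<open>|v q><v q|\<close> on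
  the sites of \<open>R\<close>, tensored with the identity elsewhere. \<open>R\<close> may exceed
  \<open>n\<close>, which allows complements \<open>- S\<close> and \<open>UNIV\<close>.\<close>

definition site_projector :: "nat \<Rightarrow> (nat \<Rightarrow> complex vec) \<Rightarrow> nat set \<Rightarrow> complex mat" where
  "site_projector n v R = tensor_mats n (\<lambda>q a b.
     if q \<in> R then v q $ of_bool a * cnj (v q $ of_bool b) else of_bool (a = b))"

lemma site_projector_carrier [simp]: "site_projector n v R \<in> carrier_mat (2 ^ n) (2 ^ n)"
  by (simp add: site_projector_def)

lemma acts_on_site_projector: "acts_on n R (site_projector n v R)"
  unfolding site_projector_def by (rule acts_on_tensor_mats) simp

lemma mat_adjoint_site_projector: "mat_adjoint (site_projector n v R) = site_projector n v R"
proof (rule eq_matI)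
  fix i j assume "i < dim_row (site_projector n v R)" "j < dim_col (site_projector n v R)"
  then have "i < 2 ^ n" "j < 2 ^ n" by (auto simp: site_projector_def tensor_mats_def)
  then show "mat_adjoint (site_projector n v R) $$ (i, j) = site_projector n v R $$ (i, j)"
    by (auto simp: mat_adjoint_index[of _ "2 ^ n" "2 ^ n"] site_projector_def tensor_mats_index intro!: prod.cong)
qed (auto simp: site_projector_def tensor_mats_def mat_adjoint_def)

lemma unit_qubit_sum:
  assumes "v \<in> carrier_vec 2" "l2_norm v = 1"
  shows "cnj (v $ 0) * v $ 0 + cnj (v $ 1) * v $ 1 = 1"
proof -
  have "v \<bullet>c v = (\<Sum>l<2. v $ l * cnj (v $ l))" by (rule cscalar_prod_sum) (use assms in auto)
  also have "\<dots> = v $ 0 * cnj (v $ 0) + v $ 1 * cnj (v $ 1)" by (simp add: numeral_2_eq_2)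
  finally have eq: "v \<bullet>c v = v $ 0 * cnj (v $ 0) + v $ 1 * cnj (v $ 1)" .
  have "Re (v \<bullet>c v) = 1" using assms(2) by (simp add: l2_norm_def)
  moreover have "Im (v \<bullet>c v) = 0" unfolding eq by simp
  ultimately have "v \<bullet>c v = 1" by (simp add: complex_eq_iff)
  then show ?thesis unfolding eq by (simp add: mult.commute)
qed

lemma site_projector_fixes:
  assumes "\<And>q. q < n \<Longrightarrow> v q \<in> carrier_vec 2 \<and> l2_norm (v q) = 1"
  shows "site_projector n v R *\<^sub>v tensor_vecs n v = tensor_vecs n v"
proof -
  have *: "v q $ a * cnj (v q $ 0) * v q $ 0 + v q $ a * cnj (v q $ 1) * v q $ 1 = v q $ a" if "q < n" for q a
    using unit_qubit_sum[of "v q"] assms[OF that] by (metis distrib_left mult.assoc mult.right_neutral)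
  show ?thesis
    unfolding site_projector_def tensor_mats_mult_vec
    by (subst tensor_vecs_def) (auto intro!: eq_vecI prod.cong simp: *[unfolded One_nat_def])
qed

text \<open>At every site a factor \<open>|v><v|\<close> meets either the identity or itself, and it
  is idempotent because \<open>v\<close> is a unit vector.\<close>

lemma site_projector_mult:
  assumes "\<And>q. q < n \<Longrightarrow> v q \<in> carrier_vec 2 \<and> l2_norm (v q) = 1" "{..<n} \<subseteq> R \<union> R'"
  shows "site_projector n v R * site_projector n v R' = site_projector n v UNIV"
proof -
  have *: "v q $ a * cnj (v q $ 0) * (v q $ 0 * b) + v q $ a * cnj (v q $ 1) * (v q $ 1 * b) = v q $ a * b"
    if "q < n" for q a b
  proof -
    have "v q $ a * cnj (v q $ 0) * (v q $ 0 * b) + v q $ a * cnj (v q $ 1) * (v q $ 1 * b)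
        = v q $ a * (cnj (v q $ 0) * v q $ 0 + cnj (v q $ 1) * v q $ 1) * b"
      by (simp add: algebra_simps)
    then show ?thesis using unit_qubit_sum[of "v q"] assms(1)[OF that] by simp
  qed
  show ?thesis
    unfolding site_projector_def tensor_mats_mult
  proof (rule tensor_mats_cong)
    fix q a b assume q: "q < n"
    then have "q \<in> R \<or> q \<in> R'" using assms(2) by auto
    then show "(if q \<in> R then v q $ of_bool a * cnj (v q $ of_bool False) else of_bool (a = False)) *
        (if q \<in> R' then v q $ of_bool False * cnj (v q $ of_bool b) else of_bool (False = b)) +
        (if q \<in> R then v q $ of_bool a * cnj (v q $ of_bool True) else of_bool (a = True)) *
        (if q \<in> R' then v q $ of_bool True * cnj (v q $ of_bool b) else of_bool (True = b))
      = (if q \<in> UNIV then v q $ of_bool a * cnj (v q $ of_bool b) else of_bool (a = b))"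
      using *[OF q] by (cases "q \<in> R"; cases "q \<in> R'"; cases a; cases b) auto
  qed
qed

lemma site_projector_UNIV:
  assumes "w \<in> carrier_vec (2 ^ n)"
  shows "site_projector n v UNIV *\<^sub>v w = (w \<bullet>c tensor_vecs n v) \<cdot>\<^sub>v tensor_vecs n v"
proof (rule eq_vecI)
  have t: "tensor_vecs n v \<in> carrier_vec (2 ^ n)" by (simp add: tensor_vecs_def)
  fix i assume "i < dim_vec ((w \<bullet>c tensor_vecs n v) \<cdot>\<^sub>v tensor_vecs n v)"
  then have i: "i < 2 ^ n" using t by simp
  have "(site_projector n v UNIV *\<^sub>v w) $ i
     = (\<Sum>k<2 ^ n. tensor_vecs n v $ i * (w $ k * cnj (tensor_vecs n v $ k)))"
    unfolding mult_mat_vec_index[OF site_projector_carrier assms i]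
    using i by (intro sum.cong) (auto simp: site_projector_def tensor_mats_index tensor_vecs_def prod.distrib)
  then show "(site_projector n v UNIV *\<^sub>v w) $ i = ((w \<bullet>c tensor_vecs n v) \<cdot>\<^sub>v tensor_vecs n v) $ i"
    using i t by (simp add: cscalar_prod_sum[OF assms t] sum_distrib_left[symmetric] mult.commute)
qed (simp add: tensor_vecs_def site_projector_def)

text \<open>\<open>A\<close> commutes with the projector onto \<open>\<phi>\<close> outside \<open>S\<close> and \<open>B\<close> with the one outside \<open>T\<close>.
  Since every qubit lies outside \<open>S\<close> or outside \<open>T\<close>, the product of the two, inserted between
  \<open>A\<close> and \<open>B\<close>, is the projector onto \<open>\<phi>\<close>.\<close>

lemma product_state_uncorrelated:
  assumes A: "acts_on n S A" and B: "acts_on n T B" and disj: "S \<inter> T = {}"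
    and prod: "is_product_state n \<phi>"
  shows "((A * B) *\<^sub>v \<phi>) \<bullet>c \<phi> = ((A *\<^sub>v \<phi>) \<bullet>c \<phi>) * ((B *\<^sub>v \<phi>) \<bullet>c \<phi>)"
proof -
  obtain v where v: "\<And>q. q < n \<Longrightarrow> v q \<in> carrier_vec 2 \<and> l2_norm (v q) = 1" and \<phi>: "\<phi> = tensor_vecs n v"
    using prod by (auto simp: is_product_state_def)
  define P where "P R = site_projector n v R" for R
  note cA = acts_on_carrier[OF A] and cB = acts_on_carrier[OF B]
  have cP: "P R \<in> carrier_mat (2 ^ n) (2 ^ n)" for R by (simp add: P_def)
  have c\<phi>: "\<phi> \<in> carrier_vec (2 ^ n)" by (simp add: \<phi> tensor_vecs_def)
  have fix\<phi>: "P R *\<^sub>v \<phi> = \<phi>" for R unfolding P_def \<phi> by (rule site_projector_fixes[OF v])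
  have PA: "P (- S) * A = A * P (- S)"
    unfolding P_def by (rule acts_on_disjoint_commute[OF acts_on_site_projector A]) auto
  have PB: "P (- T) * B = B * P (- T)"
    unfolding P_def by (rule acts_on_disjoint_commute[OF acts_on_site_projector B]) auto
  have cv: "M *\<^sub>v w \<in> carrier_vec (2 ^ n)"
    if "M \<in> carrier_mat (2 ^ n) (2 ^ n)" "w \<in> carrier_vec (2 ^ n)" for M :: "complex mat" and w
    using that by auto
  \<comment> \<open>\<open>P (- S)\<close> is taken from the second argument, where it fixes
    \<open>\<phi>\<close>, and will move right through \<open>A\<close>; \<open>P (- T)\<close> will
    move left from \<open>\<phi>\<close> through \<open>B\<close>, so that the two meet in the
    middle.\<close>
  have "((A * B) *\<^sub>v \<phi>) \<bullet>c \<phi> = (A *\<^sub>v (B *\<^sub>v \<phi>)) \<bullet>c (mat_adjoint (P (- S)) *\<^sub>v \<phi>)"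
    using cA cB c\<phi> fix\<phi> by (simp add: P_def mat_adjoint_site_projector)
  also have "\<dots> = (P (- S) *\<^sub>v (A *\<^sub>v (B *\<^sub>v \<phi>))) \<bullet>c \<phi>"
    by (rule cscalar_prod_mult_mat_vec[OF cP, symmetric]) (use cA cB cv c\<phi> in auto)
  also have "P (- S) *\<^sub>v (A *\<^sub>v (B *\<^sub>v \<phi>)) = (P (- S) * A) *\<^sub>v (B *\<^sub>v \<phi>)"
    by (rule assoc_mult_mat_vec[OF cP cA cv[OF cB c\<phi>], symmetric])
  also have "\<dots> = A *\<^sub>v (P (- S) *\<^sub>v (B *\<^sub>v \<phi>))"
    unfolding PA by (rule assoc_mult_mat_vec[OF cA cP cv[OF cB c\<phi>]])
  also have "B *\<^sub>v \<phi> = (P (- T) * B) *\<^sub>v \<phi>"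
    unfolding PB using assoc_mult_mat_vec[OF cB cP c\<phi>] fix\<phi> by simp
  also have "\<dots> = P (- T) *\<^sub>v (B *\<^sub>v \<phi>)"
    by (rule assoc_mult_mat_vec[OF cP cB c\<phi>])
  also have "P (- S) *\<^sub>v (P (- T) *\<^sub>v (B *\<^sub>v \<phi>)) = (P (- S) * P (- T)) *\<^sub>v (B *\<^sub>v \<phi>)"
    by (rule assoc_mult_mat_vec[OF cP cP cv[OF cB c\<phi>], symmetric])
  also have "P (- S) * P (- T) = P UNIV"
    unfolding P_def by (rule site_projector_mult[OF v]) (use disj in auto)
  also have "P UNIV *\<^sub>v (B *\<^sub>v \<phi>) = ((B *\<^sub>v \<phi>) \<bullet>c \<phi>) \<cdot>\<^sub>v \<phi>"
    unfolding P_def \<phi> by (rule site_projector_UNIV) (use cv cB c\<phi> \<phi> in auto)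
  also have "A *\<^sub>v (((B *\<^sub>v \<phi>) \<bullet>c \<phi>) \<cdot>\<^sub>v \<phi>) = ((B *\<^sub>v \<phi>) \<bullet>c \<phi>) \<cdot>\<^sub>v (A *\<^sub>v \<phi>)"
    by (rule mult_mat_vec[OF cA c\<phi>])
  also have "\<dots> \<bullet>c \<phi> = ((B *\<^sub>v \<phi>) \<bullet>c \<phi>) * ((A *\<^sub>v \<phi>) \<bullet>c \<phi>)"
    using cv[OF cA c\<phi>] c\<phi> by (simp add: smult_scalar_prod_distrib[of _ "2 ^ n"])
  finally show ?thesis by (simp add: mult.commute)
qed

lemma is_product_state_carrier: "is_product_state n \<phi> \<Longrightarrow> \<phi> \<in> carrier_vec (2 ^ n)"
  by (auto simp: is_product_state_def tensor_vecs_def)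

lemma product_state_unit:
  assumes "is_product_state n \<phi>"
  shows "\<phi> \<bullet>c \<phi> = 1"
proof -
  obtain v where v: "\<And>q. q < n \<Longrightarrow> v q \<in> carrier_vec 2 \<and> l2_norm (v q) = 1" and \<phi>: "\<phi> = tensor_vecs n v"
    using assms by (auto simp: is_product_state_def)
  have c: "tensor_vecs n v \<in> carrier_vec (2 ^ n)" by (simp add: tensor_vecs_def)
  have "\<phi> \<bullet>c \<phi> = (\<Sum>k<(2::nat) ^ n. \<Prod>q<n. v q $ of_bool (bit k q) * cnj (v q $ of_bool (bit k q)))"
    unfolding \<phi> cscalar_prod_sum[OF c c] by (rule sum.cong) (auto simp: tensor_vecs_def prod.distrib)
  also have "\<dots> = (\<Prod>q<n. v q $ 0 * cnj (v q $ 0) + v q $ 1 * cnj (v q $ 1))"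
    using sum_prod_bits[where f = "\<lambda>q c. v q $ of_bool c * cnj (v q $ of_bool c)"] by simp
  also have "\<dots> = 1"
    using v unit_qubit_sum by (intro prod.neutral) (auto simp: mult.commute)
  finally show ?thesis .
qed

section \<open>Circuits and light cones\<close>

lemma dim_mat_adjoint [simp]: "dim_row (mat_adjoint A) = dim_col A" "dim_col (mat_adjoint A) = dim_row A"
  by (simp_all add: mat_adjoint_def)

section \<open>Operators embedded on a list of qubits\<close>

definition sub_index :: "nat list \<Rightarrow> nat \<Rightarrow> nat" where
  "sub_index qs i = horner_sum of_bool 2 (map (bit i) qs)"

lemma sub_index_less: "sub_index qs i < 2 ^ length qs"
  using horner_sum_of_bool_2_less[of "map (bit i) qs"] by (simp add: sub_index_def)

lemma bit_sub_index: "bit (sub_index qs i) l \<longleftrightarrow> l < length qs \<and> bit i (qs ! l)"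
  by (auto simp: sub_index_def bit_horner_sum_bit_iff)

lemma sub_index_cong: "(\<And>q. q \<in> set qs \<Longrightarrow> bit i q = bit j q) \<Longrightarrow> sub_index qs i = sub_index qs j"
  unfolding sub_index_def by (simp cong: map_cong)

lemma sub_index_eq_iff: "sub_index qs i = sub_index qs j \<longleftrightarrow> (\<forall>q\<in>set qs. bit i q = bit j q)"
  by (metis bit_sub_index in_set_conv_nth sub_index_cong)

lemma embed_op_carrier [simp]: "embed_op n qs G \<in> carrier_mat (2 ^ n) (2 ^ n)"
  by (simp add: embed_op_def)

lemma dim_embed_op [simp]: "dim_row (embed_op n qs G) = 2 ^ n" "dim_col (embed_op n qs G) = 2 ^ n"
  by (simp_all add: embed_op_def)

lemma embed_op_index:
  "i < 2 ^ n \<Longrightarrow> j < 2 ^ n \<Longrightarrow> embed_op n qs G $$ (i, j) =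
     (if \<forall>q<n. q \<notin> set qs \<longrightarrow> bit i q = bit j q then G $$ (sub_index qs i, sub_index qs j) else 0)"
  by (auto simp: embed_op_def sub_index_def)

lemma acts_on_embed_op: "acts_on n (set qs) (embed_op n qs G)"
  unfolding acts_on_def
proof (intro conjI allI impI)
  fix q i j assume q: "q < n" "q \<notin> set qs" and ij: "i < (2::nat) ^ n" "j < (2::nat) ^ n"
  show "embed_op n qs G $$ (i, j) = 0" if "bit i q \<noteq> bit j q"
    using ij q that by (auto simp: embed_op_index)
  have "sub_index qs (flip_bit q k) = sub_index qs k" for k
    by (rule sub_index_cong) (use q in \<open>auto simp: bit_flip_bit_nat\<close>)
  moreover have "bit (flip_bit q i) r = bit (flip_bit q j) r \<longleftrightarrow> bit i r = bit j r" for r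
    by (simp add: bit_flip_bit_nat)
  ultimately show "embed_op n qs G $$ (flip_bit q i, flip_bit q j) = embed_op n qs G $$ (i, j)"
    by (simp only: embed_op_index ij q(1) flip_bit_less)
qed simp

lemma embed_op_one: "set qs \<subseteq> {..<n} \<Longrightarrow> embed_op n qs (1\<^sub>m (2 ^ length qs)) = 1\<^sub>m (2 ^ n)"
proof (rule eq_matI)
  fix i j assume qs: "set qs \<subseteq> {..<n}" and "i < dim_row (1\<^sub>m (2 ^ n) :: complex mat)" "j < dim_col (1\<^sub>m (2 ^ n) :: complex mat)"
  then have ij: "i < 2 ^ n" "j < 2 ^ n" by auto
  have "i = j" if "\<forall>q<n. q \<notin> set qs \<longrightarrow> bit i q = bit j q" "sub_index qs i = sub_index qs j"
    by (rule nat_eq_if_bits_eq[OF ij]) (use that in \<open>auto simp: sub_index_eq_iff\<close>)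
  then show "embed_op n qs (1\<^sub>m (2 ^ length qs)) $$ (i, j) = 1\<^sub>m (2 ^ n) $$ (i, j)"
    using ij by (auto simp: embed_op_index sub_index_less)
qed auto

lemma embed_op_adjoint:
  assumes "G \<in> carrier_mat (2 ^ length qs) (2 ^ length qs)"
  shows "mat_adjoint (embed_op n qs G) = embed_op n qs (mat_adjoint G)"
proof (rule eq_matI)
  fix i j assume "i < dim_row (embed_op n qs (mat_adjoint G))" "j < dim_col (embed_op n qs (mat_adjoint G))"
  then have ij: "i < 2 ^ n" "j < 2 ^ n" by auto
  then show "mat_adjoint (embed_op n qs G) $$ (i, j) = embed_op n qs (mat_adjoint G) $$ (i, j)"
    unfolding mat_adjoint_index[OF embed_op_carrier ij]
    by (simp add: embed_op_index mat_adjoint_index[OF assms] sub_index_less) auto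
qed auto

lemma bij_betw_sub_index:
  assumes qs: "distinct qs" "set qs \<subseteq> {..<n}" and i: "i < 2 ^ n"
  shows "bij_betw (sub_index qs) {k. k < 2 ^ n \<and> (\<forall>q<n. q \<notin> set qs \<longrightarrow> bit i q = bit k q)} {..<2 ^ length qs}"
    (is "bij_betw _ ?K _")
proof (rule bij_betw_imageI)
  show "inj_on (sub_index qs) ?K"
  proof (rule inj_onI)
    fix k k' assume k: "k \<in> ?K" "k' \<in> ?K" and eq: "sub_index qs k = sub_index qs k'"
    show "k = k'"
    proof (rule nat_eq_if_bits_eq)
      fix q assume "q < n"
      then show "bit k q = bit k' q" using k eq by (cases "q \<in> set qs") (auto simp: sub_index_eq_iff)
    qed (use k in auto)
  qed
  have "c \<in> sub_index qs ` ?K" if c: "c < 2 ^ length qs" for c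
  proof -
    have "\<forall>q\<in>set qs. \<exists>l. l < length qs \<and> qs ! l = q" by (simp add: in_set_conv_nth)
    from bchoice[OF this] obtain pos
      where pos: "\<And>q. q \<in> set qs \<Longrightarrow> pos q < length qs \<and> qs ! pos q = q" by blast
    define k where "k = nat_of_bits n (\<lambda>q. if q \<in> set qs then bit c (pos q) else bit i q)"
    \<comment> \<open>Distinctness of \<open>qs\<close> enters here: a repeated qubit would force
      two bits of \<open>c\<close> to agree.\<close>
    have "pos (qs ! l) = l" if "l < length qs" for l
      using pos[of "qs ! l"] that nth_eq_iff_index_eq[OF qs(1), of "pos (qs ! l)" l] by simp
    then have "sub_index qs k = c"
      using c qs(2) nth_mem
      by (intro nat_eq_if_bits_eq[of _ "length qs"])
         (auto simp: sub_index_less bit_sub_index k_def bit_nat_of_bits subset_iff)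
    moreover have "k \<in> ?K" by (auto simp: k_def nat_of_bits_less bit_nat_of_bits)
    ultimately show ?thesis by blast
  qed
  then show "sub_index qs ` ?K = {..<2 ^ length qs}" by (auto simp: sub_index_less)
qed

text \<open>Only intermediate states that agree with \<open>i\<close> off \<open>qs\<close>
  contribute, and \<open>sub_index qs\<close> numbers these by the indices of the small matrices, so
  the sum becomes the one in \<open>G * G'\<close>.\<close>

lemma embed_op_mult:
  assumes qs: "distinct qs" "set qs \<subseteq> {..<n}"
    and G: "G \<in> carrier_mat (2 ^ length qs) (2 ^ length qs)"
    and G': "G' \<in> carrier_mat (2 ^ length qs) (2 ^ length qs)"
  shows "embed_op n qs G * embed_op n qs G' = embed_op n qs (G * G')"
proof (rule eq_matI)
  fix i j assume "i < dim_row (embed_op n qs (G * G'))" "j < dim_col (embed_op n qs (G * G'))"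
  then have ij: "i < 2 ^ n" "j < 2 ^ n" by auto
  let ?agree = "\<lambda>i k. \<forall>q<n. q \<notin> set qs \<longrightarrow> bit (i::nat) q = bit (k::nat) q"
  let ?K = "{k. k < 2 ^ n \<and> ?agree i k}"
  have "(embed_op n qs G * embed_op n qs G') $$ (i, j)
      = (\<Sum>k<2 ^ n. embed_op n qs G $$ (i, k) * embed_op n qs G' $$ (k, j))"
    by (rule mult_mat_index[OF embed_op_carrier embed_op_carrier ij])
  also have "\<dots> = (\<Sum>k\<in>?K. embed_op n qs G $$ (i, k) * embed_op n qs G' $$ (k, j))"
    by (rule sum.mono_neutral_right) (use ij in \<open>auto simp: embed_op_index\<close>)
  also have "\<dots> = (\<Sum>k\<in>?K. if ?agree i j
      then G $$ (sub_index qs i, sub_index qs k) * G' $$ (sub_index qs k, sub_index qs j) else 0)"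
    by (rule sum.cong) (use ij in \<open>auto simp: embed_op_index\<close>)
  also have "\<dots> = (\<Sum>c<2 ^ length qs. if ?agree i j
      then G $$ (sub_index qs i, c) * G' $$ (c, sub_index qs j) else 0)"
    by (rule sum.reindex_bij_betw[OF bij_betw_sub_index[OF qs ij(1)]])
  also have "\<dots> = embed_op n qs (G * G') $$ (i, j)"
  proof -
    have "(\<Sum>c<N. if b then f c else 0) = (if b then \<Sum>c<N. f c else 0)"
      for b and f :: "nat \<Rightarrow> complex" and N
      by simp
    then show ?thesis
      by (simp only: embed_op_index[OF ij] mult_mat_index[OF G G' sub_index_less sub_index_less])
  qed
  finally show "(embed_op n qs G * embed_op n qs G') $$ (i, j) = embed_op n qs (G * G') $$ (i, j)" .
qed auto

lemma embed_op_unitary: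
  assumes qs: "distinct qs" "set qs \<subseteq> {..<n}"
    and G: "G \<in> carrier_mat (2 ^ length qs) (2 ^ length qs)" "unitary_mat G"
  shows "mat_adjoint (embed_op n qs G) * embed_op n qs G = 1\<^sub>m (2 ^ n)"
  by (simp add: embed_op_adjoint[OF G(1)] embed_op_mult[OF qs mat_adjoint_carrier[OF G(1)] G(1)]
      unitary_mat_left[OF G(2,1)] embed_op_one[OF qs(2)])

section \<open>Heisenberg evolution through one layer\<close>

lemma prod_mats_Nil [simp]: "prod_mats n [] = 1\<^sub>m (2 ^ n)"
  and prod_mats_Cons [simp]: "prod_mats n (A # As) = A * prod_mats n As"
  by (simp_all add: prod_mats_def)

lemma mat_adjoint_one: "mat_adjoint (1\<^sub>m n :: complex mat) = 1\<^sub>m n"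
  by (rule eq_matI) (auto simp: mat_adjoint_index[OF one_carrier_mat])

text \<open>In the Heisenberg picture, conjugation by \<open>V\<close> enlarges the support of an operator by at
  most the image of the involution \<open>p\<close>, which swaps the two qubits of every gate.\<close>

definition spreads_along :: "nat \<Rightarrow> (nat \<Rightarrow> nat) \<Rightarrow> complex mat \<Rightarrow> bool" where
  "spreads_along n p V \<longleftrightarrow>
     V \<in> carrier_mat (2 ^ n) (2 ^ n) \<and> mat_adjoint V * V = 1\<^sub>m (2 ^ n) \<and> (\<forall>q. p (p q) = q) \<and>
     (\<forall>S A. acts_on n S A \<longrightarrow> acts_on n (S \<union> p ` S) (mat_adjoint V * A * V))"

lemma conjugate_mult:
  fixes A V W :: "complex mat"
  assumes "V \<in> carrier_mat n n" "W \<in> carrier_mat n n" "A \<in> carrier_mat n n"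
  shows "mat_adjoint (V * W) * A * (V * W) = mat_adjoint W * (mat_adjoint V * A * V) * W"
proof -
  have c: "mat_adjoint V \<in> carrier_mat n n" "mat_adjoint W \<in> carrier_mat n n" using assms by auto
  show ?thesis
    unfolding mat_adjoint_mult[OF assms(1,2)] using assms c
    by (simp add: assoc_mult_mat[of _ n n _ n _ n] mult_carrier_mat[of _ n n _ n])
qed

lemma unitary_mult:
  fixes V W :: "complex mat"
  assumes "V \<in> carrier_mat n n" "W \<in> carrier_mat n n"
    and "mat_adjoint V * V = 1\<^sub>m n" "mat_adjoint W * W = 1\<^sub>m n"
  shows "mat_adjoint (V * W) * (V * W) = 1\<^sub>m n"
proof -
  have c: "mat_adjoint V \<in> carrier_mat n n" "mat_adjoint W \<in> carrier_mat n n" using assms by auto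
  have "mat_adjoint (V * W) * (V * W) = mat_adjoint W * (mat_adjoint V * V) * W"
    unfolding mat_adjoint_mult[OF assms(1,2)] using assms(1,2) c
    by (simp add: assoc_mult_mat[of _ n n _ n _ n] mult_carrier_mat[of _ n n _ n])
  then show ?thesis using assms c by simp
qed

text \<open>The leftmost gate conjugates \<open>A\<close> first. If it shares no qubit with the
  support, it commutes with \<open>A\<close> and cancels by unitarity; otherwise the support gains
  both of its qubits. The second conjunct carries the induction: the gates are disjoint, so the
  previous \<open>p\<close> fixes \<open>a\<close> and \<open>b\<close>, and overriding it there by
  the swap leaves an involution.\<close>

lemma gate_list_spreads:
  fixes gs :: "(nat \<times> nat \<times> complex mat) list"
  assumes "\<forall>(a, b, G) \<in> set gs. a < n \<and> b < n \<and> G \<in> carrier_mat 4 4 \<and> unitary_mat G"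
    and "distinct (concat (map (\<lambda>(a, b, G). [a, b]) gs))"
  shows "\<exists>p. spreads_along n p (prod_mats n (map (\<lambda>(a, b, G). embed_op n [a, b] G) gs)) \<and>
    (\<forall>q. q \<notin> set (concat (map (\<lambda>(a, b, G). [a, b]) gs)) \<longrightarrow> p q = q)"
  using assms
proof (induction gs)
  case Nil
  have "spreads_along n id (1\<^sub>m (2 ^ n))"
    by (auto simp: spreads_along_def mat_adjoint_one dest!: acts_on_carrier simp: acts_on_def)
  then show ?case by auto
next
  case (Cons g gs)
  obtain a b G where g: "g = (a, b, G)" by (cases g)
  let ?E = "embed_op n [a, b] G"
  define V where "V = prod_mats n (map (\<lambda>(a, b, G). embed_op n [a, b] G) gs)"
  obtain p where p: "spreads_along n p V"
    and p_id: "\<And>q. q \<notin> set (concat (map (\<lambda>(a, b, G). [a, b]) gs)) \<Longrightarrow> p q = q"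
    using Cons.IH Cons.prems by (auto simp: V_def)
  have ab: "a \<noteq> b" "p a = a" "p b = b"
    using Cons.prems(2) p_id by (auto simp: g)
  have pp: "p (p q) = q" for q using p by (simp add: spreads_along_def)
  have p_ab: "p q = a \<longleftrightarrow> q = a" "p q = b \<longleftrightarrow> q = b" for q
    using pp ab by metis+
  have E1: "mat_adjoint ?E * ?E = 1\<^sub>m (2 ^ n)"
    by (rule embed_op_unitary) (use Cons.prems ab in \<open>auto simp: g\<close>)
  have V: "V \<in> carrier_mat (2 ^ n) (2 ^ n)" "mat_adjoint V * V = 1\<^sub>m (2 ^ n)"
    using p by (auto simp: spreads_along_def)
  define p' where "p' = p(a := b, b := a)"
  have "acts_on n (S \<union> p' ` S) (mat_adjoint (?E * V) * A * (?E * V))" if A: "acts_on n S A" for S A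
  proof -
    note cA = acts_on_carrier[OF A]
    define S1 where "S1 = (if S \<inter> {a, b} = {} then S else S \<union> {a, b})"
    have "acts_on n S1 (mat_adjoint ?E * A * ?E)"
    proof (cases "S \<inter> {a, b} = {}")
      case True
      then have "A * ?E = ?E * A"
        using acts_on_disjoint_commute[OF A acts_on_embed_op] by simp
      then have "mat_adjoint ?E * A * ?E = mat_adjoint ?E * (?E * A)"
        using assoc_mult_mat[OF mat_adjoint_carrier[OF embed_op_carrier] cA embed_op_carrier] by simp
      also have "\<dots> = A"
        using assoc_mult_mat[OF mat_adjoint_carrier[OF embed_op_carrier] embed_op_carrier cA, of "[a, b]" G "[a, b]" G]
          E1 cA by simp
      finally show ?thesis using A True by (simp add: S1_def)
    next
      case False
      have "acts_on n (S \<union> {a, b}) ?E" by (rule acts_on_mono[OF acts_on_embed_op]) auto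
      then show ?thesis
        using False acts_on_mono[OF A, of "S \<union> {a, b}"]
        by (auto simp: S1_def intro!: acts_on_mult acts_on_adjoint)
    qed
    then have "acts_on n (S1 \<union> p ` S1) (mat_adjoint V * (mat_adjoint ?E * A * ?E) * V)"
      using p by (simp add: spreads_along_def)
    moreover have "S1 \<union> p ` S1 \<subseteq> S \<union> p' ` S"
      using ab by (auto simp: S1_def p'_def image_iff)
    ultimately show ?thesis
      unfolding conjugate_mult[OF embed_op_carrier V(1) cA] by (rule acts_on_mono)
  qed
  moreover have "p' (p' q) = q" for q using ab pp p_ab by (auto simp: p'_def)
  ultimately have "spreads_along n p' (?E * V)"
    using unitary_mult[OF embed_op_carrier V(1) E1 V(2)] V(1)
    by (auto simp: spreads_along_def intro!: mult_carrier_mat[OF embed_op_carrier])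
  moreover have "p' q = q" if "q \<notin> set (concat (map (\<lambda>(a, b, G). [a, b]) (g # gs)))" for q
    using that p_id[of q] by (auto simp: g p'_def)
  ultimately show ?case by (auto simp: g V_def)
qed

lemma layer_spreads: "is_layer n L \<Longrightarrow> \<exists>p. spreads_along n p L"
  unfolding is_layer_def using gate_list_spreads by blast

section \<open>Light cones as sets of qubits\<close>

definition light_cone :: "(nat \<Rightarrow> nat) list \<Rightarrow> nat set \<Rightarrow> nat set" where
  "light_cone ps S = fold (\<lambda>p S. S \<union> p ` S) ps S"

lemma light_cone_Nil [simp]: "light_cone [] S = S"
  and light_cone_Cons [simp]: "light_cone (p # ps) S = light_cone ps (S \<union> p ` S)"
  and light_cone_snoc: "light_cone (ps @ [p]) S = light_cone ps S \<union> p ` light_cone ps S"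
  by (simp_all add: light_cone_def)

lemma card_light_cone_le:
  "finite S \<Longrightarrow> finite (light_cone ps S) \<and> card (light_cone ps S) \<le> 2 ^ length ps * card S"
proof (induction ps arbitrary: S)
  case (Cons p ps)
  have "card (S \<union> p ` S) \<le> 2 * card S"
    using card_Un_le[of S "p ` S"] card_image_le[OF Cons.prems, of p] by linarith
  then have "2 ^ length ps * card (S \<union> p ` S) \<le> 2 ^ length (p # ps) * card S" by simp
  then show ?case
    using Cons.IH[of "S \<union> p ` S"] Cons.prems by (auto intro: order.trans)
qed simp

text \<open>Growth along an involution can be undone: if \<open>x = p a\<close> with
  \<open>a\<close> in \<open>A\<close>, then \<open>p x = a\<close>. A meeting point is thus traced
  back to \<open>A\<close> through the layers in reverse order.\<close>

lemma light_cone_meets_rev: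
  assumes "\<forall>p\<in>set ps. \<forall>q. p (p q) = q" "light_cone ps A \<inter> B \<noteq> {}"
  shows "A \<inter> light_cone (rev ps) B \<noteq> {}"
  using assms
proof (induction ps arbitrary: A)
  case (Cons p ps)
  then obtain x where x: "x \<in> A \<union> p ` A" "x \<in> light_cone (rev ps) B"
    by (metis Int_emptyI light_cone_Cons list.set_intros(2))
  have "p (p q) = q" for q using Cons.prems by simp
  then show ?case
    using x by (auto simp: light_cone_snoc image_iff) (metis IntI UnI2 empty_iff imageI)+
qed simp

text \<open>A meeting puts \<open>v\<close> into the reversed cone of the cone of \<open>u\<close>.
  Each of the two passes at most doubles the set once per layer, whence \<open>2 ^ length ps\<close>
  twice.\<close>

lemma card_meeting_light_cones_le:
  assumes "\<forall>p\<in>set ps. \<forall>q. p (p q) = q"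
  shows "card {v. v < n \<and> light_cone ps {u} \<inter> light_cone ps {v} \<noteq> {}} \<le> 4 ^ length ps"
proof -
  let ?C = "light_cone ps {u}"
  have C: "finite ?C" "card ?C \<le> 2 ^ length ps" using card_light_cone_le[of "{u}" ps] by auto
  have R: "finite (light_cone (rev ps) ?C)" "card (light_cone (rev ps) ?C) \<le> 2 ^ length ps * card ?C"
    using card_light_cone_le[OF C(1), of "rev ps"] by auto
  have "v \<in> light_cone (rev ps) ?C" if "?C \<inter> light_cone ps {v} \<noteq> {}" for v
    using light_cone_meets_rev[OF assms, of "{v}" ?C] that by (auto simp: Int_commute)
  then have "card {v. v < n \<and> ?C \<inter> light_cone ps {v} \<noteq> {}} \<le> card (light_cone (rev ps) ?C)"
    by (intro card_mono R) auto
  also have "\<dots> \<le> 2 ^ length ps * 2 ^ length ps"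
    using R(2) C(2) by (meson le_trans mult_le_mono2)
  finally show ?thesis by (simp add: power_mult_distrib[symmetric])
qed

text \<open>The leftmost layer, applied last to a state, conjugates an observable first, so it
  supplies the head of \<open>ps\<close>. The claim is kept general in \<open>S\<close> and
  \<open>A\<close> because the remaining layers act on an observable already evolved by
  \<open>L\<close>.\<close>

lemma circuit_spreads:
  assumes "\<forall>L\<in>set Ls. is_layer n L"
  shows "\<exists>ps. length ps = length Ls \<and> (\<forall>p\<in>set ps. \<forall>q. p (p q) = q) \<and>
    prod_mats n Ls \<in> carrier_mat (2 ^ n) (2 ^ n) \<and>
    mat_adjoint (prod_mats n Ls) * prod_mats n Ls = 1\<^sub>m (2 ^ n) \<and>
    (\<forall>S A. acts_on n S A \<longrightarrow>
      acts_on n (light_cone ps S) (mat_adjoint (prod_mats n Ls) * A * prod_mats n Ls))"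
  using assms
proof (induction Ls)
  case Nil
  have "acts_on n S (mat_adjoint (1\<^sub>m (2 ^ n)) * A * 1\<^sub>m (2 ^ n))" if "acts_on n S A" for S A
    using that acts_on_carrier[OF that] by (simp add: mat_adjoint_one)
  then show ?case by (intro exI[of _ "[]"]) (simp add: mat_adjoint_one)
next
  case (Cons L Ls)
  let ?V = "prod_mats n Ls"
  obtain ps where ps: "length ps = length Ls" "\<forall>p\<in>set ps. \<forall>q. p (p q) = q"
      "?V \<in> carrier_mat (2 ^ n) (2 ^ n)" "mat_adjoint ?V * ?V = 1\<^sub>m (2 ^ n)"
    and spread: "\<And>S A. acts_on n S A \<Longrightarrow> acts_on n (light_cone ps S) (mat_adjoint ?V * A * ?V)"
    using Cons by auto
  obtain p where p: "spreads_along n p L" by (meson Cons.prems layer_spreads list.set_intros(1))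
  then have L: "L \<in> carrier_mat (2 ^ n) (2 ^ n)" "mat_adjoint L * L = 1\<^sub>m (2 ^ n)"
    by (auto simp: spreads_along_def)
  have "acts_on n (light_cone (p # ps) S) (mat_adjoint (L * ?V) * A * (L * ?V))" if A: "acts_on n S A" for S A
    unfolding conjugate_mult[OF L(1) ps(3) acts_on_carrier[OF A]] light_cone_Cons
    by (rule spread) (use p A in \<open>auto simp: spreads_along_def\<close>)
  then show ?case
    using ps p L unitary_mult[OF L(1) ps(3) L(2) ps(4)]
    by (intro exI[of _ "p # ps"]) (auto simp: spreads_along_def)
qed

section \<open>Diagonal operators\<close>

lemma mat_adjoint_adjoint [simp]: "mat_adjoint (mat_adjoint A) = (A :: complex mat)"
proof (rule eq_matI)
  have A: "A \<in> carrier_mat (dim_row A) (dim_col A)" by simp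
  fix i j assume "i < dim_row A" "j < dim_col A"
  then show "mat_adjoint (mat_adjoint A) $$ (i, j) = A $$ (i, j)"
    by (simp add: mat_adjoint_index[OF mat_adjoint_carrier[OF A]] mat_adjoint_index[OF A])
qed auto

lemma expectation_conjugate:
  fixes M U :: "complex mat"
  assumes M: "M \<in> carrier_mat k k" and U: "U \<in> carrier_mat k k" and \<phi>: "\<phi> \<in> carrier_vec k"
  shows "((mat_adjoint U * M * U) *\<^sub>v \<phi>) \<bullet>c \<phi> = (M *\<^sub>v (U *\<^sub>v \<phi>)) \<bullet>c (U *\<^sub>v \<phi>)"
proof -
  note U' = mat_adjoint_carrier[OF U]
  have U\<phi>: "U *\<^sub>v \<phi> \<in> carrier_vec k" using U \<phi> by simp
  have "(mat_adjoint U * M * U) *\<^sub>v \<phi> = mat_adjoint U *\<^sub>v (M *\<^sub>v (U *\<^sub>v \<phi>))"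
    using assoc_mult_mat_vec[OF mult_carrier_mat[OF U' M] U \<phi>] assoc_mult_mat_vec[OF U' M U\<phi>] by simp
  then show ?thesis
    using cscalar_prod_mult_mat_vec[OF U' _ \<phi>, of "M *\<^sub>v (U *\<^sub>v \<phi>)"] M U\<phi> by simp
qed

lemma mat_diag_index: "i < k \<Longrightarrow> j < k \<Longrightarrow> mat_diag k h $$ (i, j) = (if i = j then h j else 0)"
  by (simp add: mat_diag_def)

lemma dim_mat_diag [simp]: "dim_row (mat_diag k h) = k" "dim_col (mat_diag k h) = k"
  by (simp_all add: mat_diag_def)

lemma mat_diag_mult_vec_index:
  fixes h :: "nat \<Rightarrow> complex"
  assumes "v \<in> carrier_vec k" "i < k"
  shows "(mat_diag k h *\<^sub>v v) $ i = h i * v $ i"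
proof -
  have "(mat_diag k h *\<^sub>v v) $ i = (\<Sum>l<k. if l = i then h i * v $ i else 0)"
    unfolding mult_mat_vec_index[OF mat_diag_dim assms]
    by (rule sum.cong) (use assms in \<open>auto simp: mat_diag_index\<close>)
  then show ?thesis using assms by simp
qed

lemma cscalar_prod_mat_diag:
  fixes h :: "nat \<Rightarrow> real"
  assumes v: "v \<in> carrier_vec k"
  shows "(mat_diag k (\<lambda>i. complex_of_real (h i)) *\<^sub>v v) \<bullet>c v = of_real (\<Sum>i<k. h i * (cmod (v $ i))\<^sup>2)"
proof -
  let ?Dv = "mat_diag k (\<lambda>i. complex_of_real (h i)) *\<^sub>v v"
  have "?Dv \<bullet>c v = (\<Sum>i<k. ?Dv $ i * cnj (v $ i))"
    by (rule cscalar_prod_sum[OF mult_mat_vec_carrier[OF mat_diag_dim v] v])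
  also have "\<dots> = (\<Sum>i<k. complex_of_real (h i * (cmod (v $ i))\<^sup>2))"
    by (rule sum.cong)
      (simp_all only: lessThan_iff mat_diag_mult_vec_index[OF v] of_real_mult complex_norm_square mult.assoc)
  finally show ?thesis by (simp only: of_real_sum)
qed

lemma l2_norm_squared:
  assumes "v \<in> carrier_vec k"
  shows "(l2_norm v)\<^sup>2 = (\<Sum>i<k. (cmod (v $ i))\<^sup>2)"
proof -
  have "v \<bullet>c v = of_real (\<Sum>i<k. (cmod (v $ i))\<^sup>2)"
    unfolding cscalar_prod_sum[OF assms assms] of_real_sum
    by (rule sum.cong) (simp_all only: complex_norm_square)
  then show ?thesis by (simp add: l2_norm_def sum_nonneg)
qed

lemma op_norm_mat_diag_le:
  assumes "0 < k" "0 \<le> J" "\<And>i. i < k \<Longrightarrow> cmod (h i) \<le> J"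
  shows "op_norm (mat_diag k h) \<le> J"
  unfolding op_norm_def
proof (rule cSUP_least)
  \<comment> \<open>Bounding the supremum requires some unit vector to exist, which is where
    \<open>0 < k\<close> enters.\<close>
  have "l2_norm (unit_vec k 0) = 1"
  proof -
    have "(l2_norm (unit_vec k 0))\<^sup>2 = (\<Sum>i<k. (cmod (unit_vec k 0 $ i))\<^sup>2)"
      by (rule l2_norm_squared) simp
    also have "\<dots> = (\<Sum>i<k. if i = 0 then 1 else 0)" by (rule sum.cong) auto
    also have "\<dots> = 1" using assms(1) by simp
    finally have "(l2_norm (unit_vec k 0))\<^sup>2 = 1" .
    moreover have "l2_norm (unit_vec k 0) \<ge> 0"
      using conjugate_square_ge_0_vec[of "unit_vec k 0 :: complex vec"]
      by (auto simp: l2_norm_def less_eq_complex_def)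
    ultimately show ?thesis by (simp add: power2_eq_1_iff)
  qed
  then show "{v \<in> carrier_vec (dim_col (mat_diag k h)). l2_norm v = 1} \<noteq> {}"
    by (auto intro!: exI[of _ "unit_vec k 0"])
  fix v assume "v \<in> {v \<in> carrier_vec (dim_col (mat_diag k h)). l2_norm v = 1}"
  then have v: "v \<in> carrier_vec k" "l2_norm v = 1" by auto
  have Dv: "mat_diag k h *\<^sub>v v \<in> carrier_vec k"
    by (rule mult_mat_vec_carrier[OF mat_diag_dim v(1)])
  have "(l2_norm (mat_diag k h *\<^sub>v v))\<^sup>2 = (\<Sum>i<k. (cmod (h i * v $ i))\<^sup>2)"
    unfolding l2_norm_squared[OF Dv] by (rule sum.cong) (auto simp: mat_diag_mult_vec_index[OF v(1)] simp del: index_mult_mat_vec)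
  also have "\<dots> \<le> (\<Sum>i<k. J\<^sup>2 * (cmod (v $ i))\<^sup>2)"
    using assms(3) by (intro sum_mono) (auto simp: norm_mult power_mult_distrib intro!: mult_right_mono power_mono)
  also have "\<dots> = J\<^sup>2"
    using l2_norm_squared[OF v(1)] v(2) by (simp add: sum_distrib_left[symmetric])
  finally show "l2_norm (mat_diag k h *\<^sub>v v) \<le> J"
    using assms(2) by (rule power2_le_imp_le)
qed

text \<open>At a nonzero component \<open>i\<close> of an eigenvector the eigenvalue must be
  \<open>h i\<close>. The value \<open>0\<close> is attained at the basis vector of index
  \<open>0\<close>, for the Ising model the state with all spins up.\<close>

lemma ground_state_energy_mat_diag:
  fixes h :: "nat \<Rightarrow> real"
  assumes "0 < k" "h 0 = 0" "\<And>i. i < k \<Longrightarrow> 0 \<le> h i"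
  shows "ground_state_energy (mat_diag k (\<lambda>i. complex_of_real (h i))) = 0"
  unfolding ground_state_energy_def
proof (rule Min_eqI)
  let ?D = "mat_diag k (\<lambda>i. complex_of_real (h i))"
  show "finite (Re ` spectrum ?D)"
    using card_finite_spectrum(1)[of ?D k] by simp
  show "0 \<le> x" if "x \<in> Re ` spectrum ?D" for x
  proof -
    obtain e v where x: "x = Re e" and v: "v \<in> carrier_vec k" "v \<noteq> 0\<^sub>v k" "?D *\<^sub>v v = e \<cdot>\<^sub>v v"
      using \<open>x \<in> Re ` spectrum ?D\<close> by (auto simp: spectrum_def eigenvalue_def eigenvector_def)
    obtain i where i: "i < k" "v $ i \<noteq> 0" using v by (metis carrier_vecD eq_vecI index_zero_vec)
    have "complex_of_real (h i) * v $ i = e * v $ i"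
      using mat_diag_mult_vec_index[OF v(1) i(1), of "\<lambda>i. complex_of_real (h i)"] v i by simp
    then have "e = complex_of_real (h i)" using i by simp
    then show ?thesis using i assms(3) x by simp
  qed
  have "eigenvector ?D (unit_vec k 0) 0"
    unfolding eigenvector_def
  proof (intro conjI)
    show "?D *\<^sub>v unit_vec k 0 = 0 \<cdot>\<^sub>v unit_vec k 0"
      using assms(1,2)
      by (intro eq_vecI)
        (auto simp: mat_diag_mult_vec_index[OF unit_vec_carrier] simp del: index_mult_mat_vec)
    show "unit_vec k 0 \<noteq> (0\<^sub>v (dim_row ?D) :: complex vec)"
      using assms(1) by (metis dim_mat_diag(1) index_unit_vec(2) index_zero_vec(1) zero_neq_one)
  qed simp
  then have "0 \<in> spectrum ?D" by (auto simp: spectrum_def eigenvalue_def)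
  then show "0 \<in> Re ` spectrum ?D" by force
qed

lemma sum_mats_mat_diag:
  fixes h :: "'e \<Rightarrow> nat \<Rightarrow> real"
  shows "sum_mats n (map (\<lambda>e. mat_diag (2 ^ n) (\<lambda>i. complex_of_real (h e i))) es)
    = mat_diag (2 ^ n) (\<lambda>i. complex_of_real (\<Sum>e\<leftarrow>es. h e i))"
proof (induction es)
  case Nil
  show ?case by (rule eq_matI) (auto simp: sum_mats_def mat_diag_index)
next
  case (Cons e es)
  have "sum_mats n (map (\<lambda>e. mat_diag (2 ^ n) (\<lambda>i. complex_of_real (h e i))) (e # es))
    = mat_diag (2 ^ n) (\<lambda>i. complex_of_real (h e i)) + mat_diag (2 ^ n) (\<lambda>i. complex_of_real (\<Sum>e\<leftarrow>es. h e i))"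
    using Cons.IH by (simp add: sum_mats_def)
  also have "\<dots> = mat_diag (2 ^ n) (\<lambda>i. complex_of_real (\<Sum>e\<leftarrow>e # es. h e i))"
    by (rule eq_matI) (auto simp: mat_diag_index)
  finally show ?case .
qed

lemma acts_on_mat_diag:
  assumes "\<And>q i. q < n \<Longrightarrow> q \<notin> S \<Longrightarrow> i < 2 ^ n \<Longrightarrow> h (flip_bit q i) = h i"
  shows "acts_on n S (mat_diag (2 ^ n) h)"
  unfolding acts_on_def
proof (intro conjI allI impI)
  fix q i j assume q: "q < n" "q \<notin> S" and ij: "i < (2::nat) ^ n" "j < (2::nat) ^ n"
  show "mat_diag (2 ^ n) h $$ (i, j) = 0" if "bit i q \<noteq> bit j q"
    using ij that by (auto simp: mat_diag_index)
  have "flip_bit q i = flip_bit q j \<longleftrightarrow> i = j" by (metis flip_bit_flip_bit)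
  then show "mat_diag (2 ^ n) h $$ (flip_bit q i, flip_bit q j) = mat_diag (2 ^ n) h $$ (i, j)"
    using ij q assms by (simp add: mat_diag_index flip_bit_less)
qed simp

text \<open>Entries of \<open>A\<close> whose row and column have equal bits at \<open>q\<close> do
  not depend on that bit, so \<open>B\<close> is the block where it is \<open>0\<close>, and
  \<open>ext\<close> reinserts this \<open>0\<close> into an index of the smaller system. This links
  the entrywise \<open>acts_on\<close> to the factorization that \<open>acts_trivially_on\<close>
  asks for.\<close>

lemma acts_trivially_onI:
  assumes A: "acts_on n S A" and q: "q < n" "q \<notin> S"
  shows "acts_trivially_on n q A"
proof -
  define qs where "qs = removeAll q [0..<n]"
  have set_qs: "set qs = {..<n} - {q}" by (auto simp: qs_def)
  have dist: "distinct qs" by (simp add: qs_def distinct_removeAll)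
  have len: "length qs = n - 1"
    using distinct_card[OF dist] q by (simp add: set_qs)
  have "\<forall>r\<in>set qs. \<exists>l. l < length qs \<and> qs ! l = r" by (simp add: in_set_conv_nth)
  from bchoice[OF this] obtain pos
    where pos: "\<And>r. r \<in> set qs \<Longrightarrow> pos r < length qs \<and> qs ! pos r = r" by blast
  define ext where "ext a = nat_of_bits n (\<lambda>r. r \<noteq> q \<and> bit a (pos r))" for a :: nat
  have ext_sub: "bit (ext (sub_index qs i)) r \<longleftrightarrow> bit i r" if "r < n" "r \<noteq> q" for i r
    using that pos[of r] by (auto simp: ext_def bit_nat_of_bits bit_sub_index set_qs)
  have ext_q: "\<not> bit (ext a) q" for a by (simp add: ext_def bit_nat_of_bits)
  have ext_less: "ext a < 2 ^ n" for a by (simp add: ext_def nat_of_bits_less)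
  define B where "B = mat (2 ^ (n - 1)) (2 ^ (n - 1)) (\<lambda>(a, b). A $$ (ext a, ext b))"
  note cA = acts_on_carrier[OF A]
  have A': "acts_on n (- {q}) A" using A by (rule acts_on_mono) (use q in auto)
  have "A = embed_op n qs B"
  proof (rule eq_matI)
    fix i j assume "i < dim_row (embed_op n qs B)" "j < dim_col (embed_op n qs B)"
    then have ij: "i < 2 ^ n" "j < 2 ^ n" by auto
    have agree: "(\<forall>r<n. r \<notin> set qs \<longrightarrow> bit i r = bit j r) \<longleftrightarrow> bit i q = bit j q"
      using q by (auto simp: set_qs)
    show "A $$ (i, j) = embed_op n qs B $$ (i, j)"
    proof (cases "bit i q = bit j q")
      case True
      have "A $$ (i, j) = A $$ (ext (sub_index qs i), ext (sub_index qs j))"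
        by (rule acts_on_cong[OF A']) (use ij True ext_less ext_q ext_sub in auto)
      then show ?thesis
        using True ij sub_index_less[of qs] by (simp only: embed_op_index agree if_True B_def len index_mat split refl)
    next
      case False
      then show ?thesis
        using acts_on_zero[OF A q ij False] by (simp only: embed_op_index ij agree if_False)
    qed
  qed (use cA in auto)
  moreover have "B \<in> carrier_mat (2 ^ (n - 1)) (2 ^ (n - 1))" by (simp add: B_def)
  ultimately show ?thesis unfolding acts_trivially_on_def qs_def by blast
qed

lemma support_op_subset: "acts_on n S A \<Longrightarrow> support_op n A \<subseteq> S"
  unfolding support_op_def using acts_trivially_onI by blast

section \<open>The Ising model on an expander\<close>

lemma mult_mat_vec_uminus:
  fixes A :: "complex mat"
  assumes "A \<in> carrier_mat m k" "v \<in> carrier_vec k"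
  shows "A *\<^sub>v (- v) = - (A *\<^sub>v v)"
  using assms by (intro eq_vecI) (auto simp: scalar_prod_def sum_negf)

definition spin :: "nat \<Rightarrow> nat \<Rightarrow> real" where
  "spin i u = (if bit i u then - 1 else 1)"

definition pauli_Z_on :: "nat \<Rightarrow> nat \<Rightarrow> complex mat" where
  "pauli_Z_on n u = mat_diag (2 ^ n) (\<lambda>i. complex_of_real (spin i u))"

definition ising_term :: "nat \<Rightarrow> nat \<Rightarrow> nat \<Rightarrow> complex mat" where
  "ising_term n u v = mat_diag (2 ^ n) (\<lambda>i. complex_of_real (1 - spin i u * spin i v))"

lemma spin_flip_bit: "u \<noteq> q \<Longrightarrow> spin (flip_bit q i) u = spin i u"
  by (simp add: spin_def bit_flip_bit_nat)

lemma pauli_Z_on_carrier [simp]: "pauli_Z_on n u \<in> carrier_mat (2 ^ n) (2 ^ n)"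
  by (simp add: pauli_Z_on_def)

lemma acts_on_pauli_Z: "acts_on n {u} (pauli_Z_on n u)"
  unfolding pauli_Z_on_def by (rule acts_on_mat_diag) (auto simp: spin_flip_bit)

lemma ising_term_carrier [simp]: "ising_term n u v \<in> carrier_mat (2 ^ n) (2 ^ n)"
  by (simp add: ising_term_def)

lemma support_ising_term: "support_op n (ising_term n u v) \<subseteq> {u, v}"
  unfolding ising_term_def by (intro support_op_subset acts_on_mat_diag) (auto simp: spin_flip_bit)

lemma hermitian_ising_term: "hermitian_mat (ising_term n u v)"
  unfolding hermitian_mat_def ising_term_def
  by (rule eq_matI) (auto simp: mat_adjoint_index[OF mat_diag_dim] mat_diag_index)

lemma op_norm_ising_term: "op_norm (ising_term n u v) \<le> 2"
proof -
  have "cmod (complex_of_real (1 - spin i u * spin i v)) \<le> 2" for i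
    unfolding norm_of_real by (simp add: spin_def)
  then show ?thesis unfolding ising_term_def by (intro op_norm_mat_diag_le) auto
qed

section \<open>The global spin flip\<close>

abbreviation X_all :: "nat \<Rightarrow> complex mat" where
  "X_all n \<equiv> tensor_power n pauli_X"

lemma X_all_carrier [simp]: "X_all n \<in> carrier_mat (2 ^ n) (2 ^ n)"
  by (simp add: tensor_power_def)

lemma dim_X_all [simp]: "dim_row (X_all n) = 2 ^ n" "dim_col (X_all n) = 2 ^ n"
  by (simp_all add: tensor_power_def)

lemma pauli_X_entry: "pauli_X $$ (of_bool a, of_bool b) = of_bool (a \<noteq> b)"
  by (cases a; cases b) (simp_all add: pauli_X_def mat_of_rows_list_def)

lemma X_all_index:
  "i < 2 ^ n \<Longrightarrow> j < 2 ^ n \<Longrightarrow> X_all n $$ (i, j) = (\<Prod>q<n. of_bool (bit i q \<noteq> bit j q))"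
  by (simp only: tensor_power_def index_mat split pauli_X_entry)

text \<open>The flip connects a basis state only to its bitwise complement, where all spins are
  reversed: a product of two spins keeps its value, a single spin changes sign.\<close>

lemma X_all_nonzero:
  "\<lbrakk>i < 2 ^ n; j < 2 ^ n; X_all n $$ (i, j) \<noteq> 0; u < n\<rbrakk> \<Longrightarrow> spin j u = - spin i u"
  by (auto simp: X_all_index spin_def)

lemma mat_adjoint_X_all: "mat_adjoint (X_all n) = X_all n"
proof (rule eq_matI)
  fix i j assume "i < dim_row (X_all n)" "j < dim_col (X_all n)"
  then have ij: "i < 2 ^ n" "j < 2 ^ n" by auto
  have "cnj (X_all n $$ (j, i)) = (\<Prod>q<n. of_bool (bit i q \<noteq> bit j q))"
    unfolding X_all_index[OF ij(2,1)] cnj_prod by (rule prod.cong) auto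
  then show "mat_adjoint (X_all n) $$ (i, j) = X_all n $$ (i, j)"
    by (simp only: mat_adjoint_index[OF X_all_carrier ij] X_all_index[OF ij])
qed auto

lemma Z2_symmetric_ising_term:
  assumes "u < n" "v < n"
  shows "Z2_symmetric_op n (ising_term n u v)"
  unfolding Z2_symmetric_op_def ising_term_def mat_diag_mult_left[OF X_all_carrier] mat_diag_mult_right[OF X_all_carrier]
proof (rule cong_mat)
  fix i j assume ij: "i < (2::nat) ^ n" "j < (2::nat) ^ n"
  show "(case (i, j) of (i, j) \<Rightarrow> complex_of_real (1 - spin i u * spin i v) * X_all n $$ (i, j))
    = (case (i, j) of (i, j) \<Rightarrow> X_all n $$ (i, j) * complex_of_real (1 - spin j u * spin j v))"
    using X_all_nonzero[OF ij _ assms(1)] X_all_nonzero[OF ij _ assms(2)]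
    by (cases "X_all n $$ (i, j) = 0") auto
qed auto

lemma pauli_Z_anticommutes:
  assumes "u < n"
  shows "pauli_Z_on n u * X_all n = - (X_all n * pauli_Z_on n u)"
proof (rule eq_matI)
  fix i j assume "i < dim_row (- (X_all n * pauli_Z_on n u))" "j < dim_col (- (X_all n * pauli_Z_on n u))"
  then have ij: "i < 2 ^ n" "j < 2 ^ n" by (auto simp: pauli_Z_on_def)
  then show "(pauli_Z_on n u * X_all n) $$ (i, j) = (- (X_all n * pauli_Z_on n u)) $$ (i, j)"
    using X_all_nonzero[OF ij _ assms]
    unfolding pauli_Z_on_def mat_diag_mult_left[OF X_all_carrier] mat_diag_mult_right[OF X_all_carrier]
    by (cases "X_all n $$ (i, j) = 0") auto
qed (auto simp: pauli_Z_on_def)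

text \<open>Moving the Hermitian flip across the inner product yields the same expectation with
  opposite sign. The eigenvalue \<open>1\<close> or \<open>-1\<close> enters once on each side and
  drops out, so both parities are covered.\<close>

lemma symmetric_state_magnetization_zero:
  assumes \<psi>: "\<psi> \<in> carrier_vec (2 ^ n)" and sym: "Z2_symmetric_state n \<psi>" and u: "u < n"
  shows "(pauli_Z_on n u *\<^sub>v \<psi>) \<bullet>c \<psi> = 0"
proof -
  let ?Z = "pauli_Z_on n u" and ?X = "X_all n"
  have Z\<psi>: "?Z *\<^sub>v \<psi> \<in> carrier_vec (2 ^ n)" and X\<psi>: "?X *\<^sub>v \<psi> \<in> carrier_vec (2 ^ n)"
    using mult_mat_vec_carrier[OF pauli_Z_on_carrier \<psi>] mult_mat_vec_carrier[OF X_all_carrier \<psi>] by auto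
  have XZ\<psi>: "?X *\<^sub>v (?Z *\<^sub>v \<psi>) \<in> carrier_vec (2 ^ n)"
    using mult_mat_vec_carrier[OF X_all_carrier Z\<psi>] .
  have "?Z *\<^sub>v (?X *\<^sub>v \<psi>) = (?Z * ?X) *\<^sub>v \<psi>"
    by (rule assoc_mult_mat_vec[OF pauli_Z_on_carrier X_all_carrier \<psi>, symmetric])
  also have "\<dots> = - ((?X * ?Z) *\<^sub>v \<psi>)"
    unfolding pauli_Z_anticommutes[OF u]
    by (rule uminus_mult_mat_vec) (use \<psi> in \<open>simp add: pauli_Z_on_def\<close>)
  also have "(?X * ?Z) *\<^sub>v \<psi> = ?X *\<^sub>v (?Z *\<^sub>v \<psi>)"
    by (rule assoc_mult_mat_vec[OF X_all_carrier pauli_Z_on_carrier \<psi>])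
  finally have "(?Z *\<^sub>v (?X *\<^sub>v \<psi>)) \<bullet>c \<psi> = - ((?X *\<^sub>v (?Z *\<^sub>v \<psi>)) \<bullet>c \<psi>)"
    using XZ\<psi> \<psi> by (simp del: index_mult_mat_vec)
  also have "(?X *\<^sub>v (?Z *\<^sub>v \<psi>)) \<bullet>c \<psi> = (?Z *\<^sub>v \<psi>) \<bullet>c (?X *\<^sub>v \<psi>)"
    using cscalar_prod_mult_mat_vec[OF X_all_carrier Z\<psi> \<psi>] by (simp add: mat_adjoint_X_all)
  finally have anti: "(?Z *\<^sub>v (?X *\<^sub>v \<psi>)) \<bullet>c \<psi> = - ((?Z *\<^sub>v \<psi>) \<bullet>c (?X *\<^sub>v \<psi>))" .
  consider "?X *\<^sub>v \<psi> = \<psi>" | "?X *\<^sub>v \<psi> = - \<psi>" using sym by (auto simp: Z2_symmetric_state_def)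
  then show ?thesis
  proof cases
    case 1
    then show ?thesis using anti by simp
  next
    case 2
    have "?Z *\<^sub>v (- \<psi>) = - (?Z *\<^sub>v \<psi>)"
      by (rule mult_mat_vec_uminus[OF pauli_Z_on_carrier \<psi>])
    moreover have "conjugate (- \<psi>) = - conjugate \<psi>"
      by (rule eq_vecI) auto
    moreover have "(- (?Z *\<^sub>v \<psi>)) \<bullet>c \<psi> = - ((?Z *\<^sub>v \<psi>) \<bullet>c \<psi>)"
      by (rule scalar_prod_uminus_left) (use \<psi> in \<open>simp add: pauli_Z_on_def\<close>)
    moreover have "(?Z *\<^sub>v \<psi>) \<bullet> (- conjugate \<psi>) = - ((?Z *\<^sub>v \<psi>) \<bullet>c \<psi>)"
      by (rule scalar_prod_uminus_right) (use \<psi> in \<open>simp add: pauli_Z_on_def\<close>)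
    ultimately have "- ((?Z *\<^sub>v \<psi>) \<bullet>c \<psi>) = (?Z *\<^sub>v \<psi>) \<bullet>c \<psi>"
      using anti unfolding 2 by (simp only: minus_minus)
    then show ?thesis by simp
  qed
qed

text \<open>The symmetry of \<open>U\<close> as a whole carries that of \<open>\<phi>\<close> to the
  output, where the mean of \<open>pauli_Z_on n u\<close> vanishes. One vanishing factor makes the
  factorized correlation zero, hence the range condition on \<open>u\<close> alone.\<close>

lemma circuit_spin_uncorrelated:
  assumes U: "U \<in> carrier_mat (2 ^ n) (2 ^ n)" "mat_adjoint U * U = 1\<^sub>m (2 ^ n)" "Z2_symmetric_op n U"
    and \<phi>: "is_product_state n \<phi>" "Z2_symmetric_state n \<phi>"
    and A: "acts_on n S (mat_adjoint U * pauli_Z_on n u * U)"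
    and B: "acts_on n T (mat_adjoint U * pauli_Z_on n v * U)"
    and disj: "S \<inter> T = {}" and u: "u < n"
  shows "(\<Sum>i<2 ^ n. spin i u * spin i v * (cmod ((U *\<^sub>v \<phi>) $ i))\<^sup>2) = 0"
proof -
  let ?Zu = "pauli_Z_on n u" and ?Zv = "pauli_Z_on n v" and ?U' = "mat_adjoint U" and ?\<psi> = "U *\<^sub>v \<phi>"
  have c\<phi>: "\<phi> \<in> carrier_vec (2 ^ n)" by (rule is_product_state_carrier[OF \<phi>(1)])
  have c\<psi>: "?\<psi> \<in> carrier_vec (2 ^ n)" using U(1) c\<phi> by simp
  note U' = mat_adjoint_carrier[OF U(1)]
  have UU': "U * ?U' = 1\<^sub>m (2 ^ n)"
    by (rule mat_mult_left_right_inverse[OF U' U(1) U(2)])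
  have Zs: "?Zu * ?Zv = mat_diag (2 ^ n) (\<lambda>i. complex_of_real (spin i u * spin i v))"
    unfolding pauli_Z_on_def by simp
  have "X_all n *\<^sub>v ?\<psi> = U *\<^sub>v (X_all n *\<^sub>v \<phi>)"
    using assoc_mult_mat_vec[OF X_all_carrier U(1) c\<phi>] assoc_mult_mat_vec[OF U(1) X_all_carrier c\<phi>] U(3)
    by (simp add: Z2_symmetric_op_def)
  moreover have "U *\<^sub>v (- \<phi>) = - ?\<psi>"
    by (rule mult_mat_vec_uminus[OF U(1) c\<phi>])
  ultimately have "Z2_symmetric_state n ?\<psi>"
    using \<phi>(2) by (auto simp: Z2_symmetric_state_def)
  then have "(?Zu *\<^sub>v ?\<psi>) \<bullet>c ?\<psi> = 0"
    by (rule symmetric_state_magnetization_zero[OF c\<psi> _ u])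
  then have Zu0: "((?U' * ?Zu * U) *\<^sub>v \<phi>) \<bullet>c \<phi> = 0"
    using expectation_conjugate[OF pauli_Z_on_carrier U(1) c\<phi>] by simp
  \<comment> \<open>As \<open>U * ?U'\<close> is the identity, evolution is multiplicative: the
    correlation of the evolved operators in \<open>\<phi>\<close> is that of the two spins in the
    output.\<close>
  have "(?U' * ?Zu * U) * (?U' * ?Zv * U) = ?U' * ?Zu * (U * ?U') * (?Zv * U)"
    using U(1) U' by (simp add: assoc_mult_mat[of _ "2 ^ n" "2 ^ n" _ "2 ^ n" _ "2 ^ n"]
        mult_carrier_mat[of _ "2 ^ n" "2 ^ n" _ "2 ^ n"])
  also have "\<dots> = ?U' * (?Zu * ?Zv) * U"
    unfolding UU' using U(1) U' by (simp add: assoc_mult_mat[of _ "2 ^ n" "2 ^ n" _ "2 ^ n" _ "2 ^ n"]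
        left_mult_one_mat[OF mult_carrier_mat[OF pauli_Z_on_carrier U(1)]] mult_carrier_mat[of _ "2 ^ n" "2 ^ n" _ "2 ^ n"])
  finally have prod: "(?U' * ?Zu * U) * (?U' * ?Zv * U) = ?U' * (?Zu * ?Zv) * U" .
  have "((?U' * (?Zu * ?Zv) * U) *\<^sub>v \<phi>) \<bullet>c \<phi> = 0"
    using product_state_uncorrelated[OF A B disj \<phi>(1)] Zu0 by (simp only: prod mult_zero_left)
  then have "((?Zu * ?Zv) *\<^sub>v ?\<psi>) \<bullet>c ?\<psi> = 0"
    using expectation_conjugate[OF mult_carrier_mat[OF pauli_Z_on_carrier pauli_Z_on_carrier] U(1) c\<phi>] by simp
  then show ?thesis
    unfolding Zs cscalar_prod_mat_diag[OF c\<psi>] by (simp only: of_real_eq_0_iff)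
qed



section \<open>The graph and the energy of a basis state\<close>

lemma length_filter_mono:
  "(\<And>x. x \<in> set xs \<Longrightarrow> P x \<Longrightarrow> Q x) \<Longrightarrow> length (filter P xs) \<le> length (filter Q xs)"
  by (induction xs) (auto simp: le_SucI)

text \<open>The edge list can repeat entries, as permutations may coincide; dropping nonnegative
  repetitions only lowers the energy.\<close>

lemma sum_set_le_sum_list:
  fixes f :: "'a \<Rightarrow> real"
  assumes "\<And>x. x \<in> set xs \<Longrightarrow> 0 \<le> f x"
  shows "sum f (set xs) \<le> (\<Sum>x\<leftarrow>xs. f x)"
  using assms
proof (induction xs)
  case (Cons x xs)
  then have "sum f (set xs) \<le> (\<Sum>x\<leftarrow>xs. f x)" "0 \<le> f x" by auto
  then show ?case by (cases "x \<in> set xs") (auto simp: insert_absorb)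
qed simp

text \<open>A fixed point of a permutation gives a loop, whose interaction term is zero.\<close>

definition graph_edges :: "(nat \<Rightarrow> nat) list \<Rightarrow> nat \<Rightarrow> (nat \<times> nat) list" where
  "graph_edges ps n = map (\<lambda>(p, u). (u, p u)) (List.product ps [0..<n])"

definition cut_energy :: "(nat \<Rightarrow> nat) list \<Rightarrow> nat \<Rightarrow> nat \<Rightarrow> real" where
  "cut_energy ps n i = (\<Sum>(u, v)\<leftarrow>graph_edges ps n. 1 - spin i u * spin i v)"

lemma spin_product_le_1: "spin i u * spin i v \<le> 1"
  by (simp add: spin_def)

text \<open>Each permutation gives \<open>q\<close> at most one outgoing edge, at
  \<open>u = q\<close>, and one incoming edge, from the preimage of \<open>q\<close>.\<close>

lemma length_incident_edges_le:
  assumes "\<And>p. p \<in> set ps \<Longrightarrow> p permutes {..<n}"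
  shows "length (filter (\<lambda>(u, v). q = u \<or> q = v) (graph_edges ps n)) \<le> 2 * length ps"
  using assms
proof (induction ps)
  case (Cons p ps)
  have inj: "inj p" using Cons.prems permutes_inj by auto
  have "length (filter (\<lambda>u. q = u \<or> q = p u) [0..<n]) = card {u. u < n \<and> (q = u \<or> q = p u)}"
    by (subst distinct_card[symmetric]) (auto intro!: arg_cong[where f = card])
  also have "\<dots> \<le> card {q, inv_into UNIV p q}"
    by (rule card_mono) (use inj in \<open>auto simp: inv_f_eq\<close>)
  also have "\<dots> \<le> 2" by (simp add: card_insert_if)
  finally have "length (filter (\<lambda>u. q = u \<or> q = p u) [0..<n]) \<le> 2" .
  then show ?case
    using Cons.IH Cons.prems by (simp add: graph_edges_def filter_map o_def split_def)
qed (simp add: graph_edges_def)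

lemma cut_energy_nonneg: "0 \<le> cut_energy ps n i"
  unfolding cut_energy_def by (rule sum_list_nonneg) (use spin_product_le_1 in auto)

text \<open>Every outer boundary vertex is \<open>p u\<close> for some \<open>u\<close> in
  \<open>S\<close>, so there are at least as many crossing pairs \<open>(p, u)\<close> as boundary
  vertices, and each of them costs \<open>2\<close>.\<close>

lemma cut_energy_ge_boundary:
  assumes S: "S \<subseteq> {..<n}" and cut: "\<And>u v. u \<in> S \<Longrightarrow> v \<notin> S \<Longrightarrow> v < n \<Longrightarrow> spin i u \<noteq> spin i v"
    and perm: "\<And>p. p \<in> set ps \<Longrightarrow> p permutes {..<n}"
  shows "2 * real (card ((\<Union>p\<in>set ps. p ` S) - S)) \<le> cut_energy ps n i"
proof -
  let ?f = "\<lambda>(p, u). 1 - spin i u * spin i (p u)"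
  define D where "D = {(p, u). p \<in> set ps \<and> u \<in> S \<and> p u \<notin> S}"
  have DP: "D \<subseteq> set (List.product ps [0..<n])" using S by (auto simp: D_def)
  then have finD: "finite D" by (rule finite_subset) simp
  have "(\<Union>p\<in>set ps. p ` S) - S \<subseteq> (\<lambda>(p, u). p u) ` D"
    by (force simp: D_def)
  then have "card ((\<Union>p\<in>set ps. p ` S) - S) \<le> card D"
    by (meson card_image_le card_mono finD finite_imageI le_trans)
  then have "2 * real (card ((\<Union>p\<in>set ps. p ` S) - S)) \<le> (\<Sum>e\<in>D. 2)" by simp
  also have "\<dots> = sum ?f D"
  proof (rule sum.cong)
    fix e assume "e \<in> D"
    then obtain p u where e: "e = (p, u)" "p \<in> set ps" "u \<in> S" "p u \<notin> S" by (auto simp: D_def)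
    have "p u < n" using permutes_in_image[OF perm[OF e(2)], of u] e(3) S by auto
    then have "spin i u \<noteq> spin i (p u)" using cut e by simp
    then show "2 = ?f e" by (auto simp: e spin_def split: if_splits)
  qed simp
  also have "\<dots> \<le> sum ?f (set (List.product ps [0..<n]))"
    by (rule sum_mono2) (use DP spin_product_le_1 in auto)
  also have "\<dots> \<le> (\<Sum>e\<leftarrow>List.product ps [0..<n]. ?f e)"
    by (rule sum_set_le_sum_list) (use spin_product_le_1 in auto)
  also have "\<dots> = cut_energy ps n i"
    by (simp add: cut_energy_def graph_edges_def o_def split_def)
  finally show ?thesis .
qed

text \<open>With \<open>S\<close> the down spins and \<open>S'\<close> the up spins,
  \<open>n^2 - M^2\<close> is four times the product of their sizes. The smaller size is at most the
  energy, as the \<open>2\<close> paid per cut edge offsets the expansion constant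
  \<open>1/2\<close>; the larger is at most \<open>n\<close>.\<close>

lemma cut_energy_ge_magnetization:
  assumes exp: "expanding n ps" and n: "0 < n"
  shows "(real n ^ 2 - (\<Sum>u<n. spin i u)\<^sup>2) / (4 * real n) \<le> cut_energy ps n i"
proof -
  have perm: "\<And>p. p \<in> set ps \<Longrightarrow> p permutes {..<n}"
    and expand: "\<And>S. S \<subseteq> {..<n} \<Longrightarrow> S \<noteq> {} \<Longrightarrow> 2 * card S \<le> n \<Longrightarrow>
      card S < 2 * card ((\<Union>p\<in>set ps. p ` S) - S)"
    using exp by (auto simp: expanding_def)
  define S where "S = {u. u < n \<and> bit i u}"
  define S' where "S' = {..<n} - S"
  have sub: "S \<subseteq> {..<n}" "S' \<subseteq> {..<n}" by (auto simp: S_def S'_def)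
  then have fin: "finite S" "finite S'" using finite_subset by auto
  have card: "card S + card S' = n"
    using card_Un_disjoint[OF fin] sub by (auto simp: S'_def Un_absorb1)
  then have real_n: "real n = real (card S) + real (card S')" by linarith
  have lower: "real (card Q) \<le> cut_energy ps n i"
    if "Q = S \<or> Q = S'" "2 * card Q \<le> n" for Q
  proof (cases "Q = {}")
    case True
    then show ?thesis by (simp add: cut_energy_nonneg)
  next
    case False
    have Q: "Q \<subseteq> {..<n}" using that sub by auto
    have "2 * real (card ((\<Union>p\<in>set ps. p ` Q) - Q)) \<le> cut_energy ps n i"
      by (rule cut_energy_ge_boundary[OF Q _ perm]) (use that in \<open>auto simp: S_def S'_def spin_def\<close>)
    then show ?thesis using expand[OF Q False that(2)] by linarith
  qed
  have "{..<n} = S \<union> S'" "S \<inter> S' = {}" using sub by (auto simp: S'_def)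
  then have "(\<Sum>u<n. spin i u) = (\<Sum>u\<in>S. spin i u) + (\<Sum>u\<in>S'. spin i u)"
    using fin by (simp add: sum.union_disjoint)
  also have "(\<Sum>u\<in>S. spin i u) = - real (card S)" by (simp add: S_def spin_def)
  also have "(\<Sum>u\<in>S'. spin i u) = real (card S')"
    using sum.cong[of S' S' "spin i" "\<lambda>_. 1"] by (simp add: S'_def S_def spin_def)
  finally have M: "(\<Sum>u<n. spin i u) = real (card S') - real (card S)" by simp
  have "real n ^ 2 - (\<Sum>u<n. spin i u)\<^sup>2 = 4 * (real (card S) * real (card S'))"
    unfolding M real_n by (simp add: power2_eq_square algebra_simps)
  also have "real (card S) * real (card S') \<le> real n * cut_energy ps n i"
  proof (cases "2 * card S \<le> n")
    case True
    have "real (card S) * real (card S') \<le> cut_energy ps n i * real n"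
      by (intro mult_mono lower) (use True card cut_energy_nonneg in auto)
    then show ?thesis by (simp add: mult.commute)
  next
    case False
    then have "2 * card S' \<le> n" using card by linarith
    then show ?thesis
      by (intro mult_mono lower) (use card in auto)
  qed
  finally show ?thesis using n by (simp add: field_simps)
qed

section \<open>Magnetization of circuit outputs and the choice of constants\<close>

lemma circuit_magnetization_bound:
  assumes circuit: "is_circuit n d U" and sym: "Z2_symmetric_op n U"
    and \<phi>: "is_product_state n \<phi>" "Z2_symmetric_state n \<phi>"
  shows "U \<in> carrier_mat (2 ^ n) (2 ^ n)"
    and "(\<Sum>i<2 ^ n. (cmod ((U *\<^sub>v \<phi>) $ i))\<^sup>2) = 1"
    and "(\<Sum>i<2 ^ n. (\<Sum>u<n. spin i u)\<^sup>2 * (cmod ((U *\<^sub>v \<phi>) $ i))\<^sup>2) \<le> real n * 4 ^ d"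
proof -
  obtain Ls where Ls: "length Ls = d" "\<forall>L\<in>set Ls. is_layer n L" "U = prod_mats n Ls"
    using circuit by (auto simp: is_circuit_def)
  then obtain ps where ps: "length ps = d" "\<forall>p\<in>set ps. \<forall>q. p (p q) = q"
    and U: "U \<in> carrier_mat (2 ^ n) (2 ^ n)" "mat_adjoint U * U = 1\<^sub>m (2 ^ n)"
    and spread: "\<And>S A. acts_on n S A \<Longrightarrow> acts_on n (light_cone ps S) (mat_adjoint U * A * U)"
    using circuit_spreads[of Ls n] by auto
  show "U \<in> carrier_mat (2 ^ n) (2 ^ n)" by (rule U(1))
  define w where "w i = (cmod ((U *\<^sub>v \<phi>) $ i))\<^sup>2" for i
  note c\<phi> = is_product_state_carrier[OF \<phi>(1)]
  have c\<psi>: "U *\<^sub>v \<phi> \<in> carrier_vec (2 ^ n)" using U(1) c\<phi> by simp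
  have "(1\<^sub>m (2 ^ n) *\<^sub>v (U *\<^sub>v \<phi>)) \<bullet>c (U *\<^sub>v \<phi>) = ((mat_adjoint U * 1\<^sub>m (2 ^ n) * U) *\<^sub>v \<phi>) \<bullet>c \<phi>"
    by (rule expectation_conjugate[OF one_carrier_mat U(1) c\<phi>, symmetric])
  also have "mat_adjoint U * 1\<^sub>m (2 ^ n) * U = 1\<^sub>m (2 ^ n)"
    using U mat_adjoint_carrier[OF U(1)] by simp
  finally have "(U *\<^sub>v \<phi>) \<bullet>c (U *\<^sub>v \<phi>) = 1"
    using c\<phi> c\<psi> product_state_unit[OF \<phi>(1)] by simp
  then have "l2_norm (U *\<^sub>v \<phi>) = 1" by (simp add: l2_norm_def)
  then have w1: "(\<Sum>i<2 ^ n. w i) = 1"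
    using l2_norm_squared[OF c\<psi>] by (simp add: w_def)
  then show "(\<Sum>i<2 ^ n. (cmod ((U *\<^sub>v \<phi>) $ i))\<^sup>2) = 1" by (simp add: w_def)
  have w0: "w i \<ge> 0" for i by (simp add: w_def)
  define meet where "meet u = {v. v < n \<and> light_cone ps {u} \<inter> light_cone ps {v} \<noteq> {}}" for u
  have corr: "(\<Sum>i<2 ^ n. spin i u * spin i v * w i) \<le> (if v \<in> meet u then 1 else 0)"
    if uv: "u < n" "v < n" for u v
  proof (cases "v \<in> meet u")
    case True
    have "(\<Sum>i<2 ^ n. spin i u * spin i v * w i) \<le> (\<Sum>i<2 ^ n. 1 * w i)"
      by (intro sum_mono mult_right_mono spin_product_le_1 w0)
    then show ?thesis using True w1 by simp
  next
    case False
    then have "light_cone ps {u} \<inter> light_cone ps {v} = {}" using uv by (simp add: meet_def)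
    then have "(\<Sum>i<2 ^ n. spin i u * spin i v * w i) = 0"
      unfolding w_def
      using circuit_spin_uncorrelated[OF U sym \<phi> spread[OF acts_on_pauli_Z] spread[OF acts_on_pauli_Z] _ uv(1)]
      by blast
    then show ?thesis using False by simp
  qed
  have "(\<Sum>i<2 ^ n. (\<Sum>u<n. spin i u)\<^sup>2 * w i) = (\<Sum>i<2 ^ n. \<Sum>u<n. \<Sum>v<n. spin i u * spin i v * w i)"
    by (simp only: power2_eq_square sum_product, simp only: sum_distrib_right)
  also have "\<dots> = (\<Sum>u<n. \<Sum>v<n. \<Sum>i<2 ^ n. spin i u * spin i v * w i)"
    by (subst sum.swap) (intro sum.cong refl sum.swap)
  also have "\<dots> \<le> (\<Sum>u<n. \<Sum>v<n. if v \<in> meet u then 1 else 0)"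
    by (intro sum_mono corr) auto
  also have "\<dots> = (\<Sum>u<n. real (card (meet u)))"
  proof (rule sum.cong)
    fix u
    have "{..<n} \<inter> meet u = meet u" by (auto simp: meet_def)
    then show "(\<Sum>v<n. if v \<in> meet u then 1 else 0) = real (card (meet u))"
      by (simp add: sum.If_cases Collect_mem_eq)
  qed simp
  also have "\<dots> \<le> (\<Sum>u<n. 4 ^ d)"
  proof (intro sum_mono)
    fix u
    have "card (meet u) \<le> 4 ^ d"
      using card_meeting_light_cones_le[OF ps(2), of n u] ps(1) by (simp add: meet_def)
    then show "real (card (meet u)) \<le> 4 ^ d"
      by (metis of_nat_le_iff of_nat_numeral of_nat_power)
  qed
  also have "\<dots> = real n * 4 ^ d" by simp
  finally show "(\<Sum>i<2 ^ n. (\<Sum>u<n. spin i u)\<^sup>2 * (cmod ((U *\<^sub>v \<phi>) $ i))\<^sup>2) \<le> real n * 4 ^ d"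
    by (simp add: w_def)
qed

text \<open>The exponent \<open>3 d\<close>, above the \<open>2 d\<close> at which
  \<open>4 ^ d\<close> reaches \<open>n\<close>, leaves a linear gap: for \<open>d = k + 1\<close>,
  \<open>4 * 4 ^ d\<close> is \<open>16 * 4 ^ k\<close>, less than \<open>24 * 8 ^ k\<close>, which
  is at most \<open>3 * n\<close>. For \<open>d = 0\<close> the claim is \<open>4 < 3 * n\<close>,
  whence \<open>2 \<le> n\<close>.\<close>

lemma shallow_size_bound:
  assumes "2 \<le> n" "2 powr (3 * real d) \<le> real n"
  shows "4 * 4 ^ d < 3 * real n"
proof (cases d)
  case 0
  then show ?thesis using assms by simp
next
  case (Suc k)
  have "2 powr (3 * real d) = (8::real) ^ d"
    by (simp add: powr_powr[symmetric] powr_realpow)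
  then have "8 * (8::real) ^ k \<le> real n" using assms(2) Suc by simp
  moreover have "(4::real) ^ k \<le> 8 ^ k" by (rule power_mono) auto
  moreover have "(0::real) < 8 ^ k" by simp
  ultimately show ?thesis unfolding Suc power_Suc by linarith
qed

definition ising_terms :: "(nat \<Rightarrow> nat) list \<Rightarrow> nat \<Rightarrow> complex mat list" where
  "ising_terms ps n = map (\<lambda>(u, v). ising_term n u v) (graph_edges ps n)"

lemma sum_ising_terms:
  "sum_mats n (ising_terms ps n) = mat_diag (2 ^ n) (\<lambda>i. complex_of_real (cut_energy ps n i))"
  using sum_mats_mat_diag[where h = "\<lambda>(u, v) i. 1 - spin i u * spin i v"]
  by (simp add: ising_terms_def cut_energy_def ising_term_def split_def)

theorem theorem1:
  shows "\<exists>(\<epsilon>::real) (c::real) (I::nat set) (T :: nat \<Rightarrow> complex mat list).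
    \<epsilon> > 0 \<and> c > 0 \<and> infinite I \<and> (\<forall>n\<in>I. n > 0) \<and>
    local_hamiltonian_family I T \<and>
    (\<forall>n\<in>I. Z2_symmetric_hamiltonian n (T n)) \<and>
    (\<forall>n\<in>I. ground_state_energy (sum_mats n (T n)) = 0) \<and>
    (\<forall>n\<in>I. \<forall>(d::nat) U \<phi>.
       real n \<ge> 2 powr (c * real d) \<longrightarrow>
       is_circuit n d U \<longrightarrow> Z2_symmetric_op n U \<longrightarrow>
       is_product_state n \<phi> \<longrightarrow> Z2_symmetric_state n \<phi> \<longrightarrow>
       expectation (mat_adjoint U * sum_mats n (T n) * U) \<phi> > \<epsilon> * real n)"
proof -
  have "\<forall>n. \<exists>ps. length ps = 15 \<and> expanding n ps"
    using expanding_permutations_exist by blast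
  from choice[OF this] obtain ps where len: "\<And>n. length (ps n) = 15" and exp: "\<And>n. expanding n (ps n)"
    by auto
  have perm: "p permutes {..<n}" if "p \<in> set (ps n)" for p n
    using exp[of n] that by (simp add: expanding_def)
  define T where "T n = ising_terms (ps n) n" for n
  have edge: "u < n \<and> v < n" if "(u, v) \<in> set (graph_edges (ps n) n)" for u v n
    using that permutes_in_image[OF perm] by (fastforce simp: graph_edges_def)
  have T_set: "\<exists>u v. u < n \<and> v < n \<and> A = ising_term n u v" if "A \<in> set (T n)" for A n
    using that unfolding T_def ising_terms_def by (force dest: edge)
  \<comment> \<open>Size \<open>1\<close> is excluded: all its edges are loops, so its Hamiltonian
    is zero.\<close>
  have "local_hamiltonian_family {2..} T"
    unfolding local_hamiltonian_family_def
  \<comment> \<open>Two qubits per term, norm at most \<open>2\<close>, and \<open>2 * 15\<close>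
    edges at each qubit.\<close>
  proof (rule exI[of _ "2::nat"], rule exI[of _ "2::real"], rule exI[of _ "30::nat"],
      intro ballI conjI allI impI)
    fix n A assume "A \<in> set (T n)"
    then obtain u v where A: "A = ising_term n u v" using T_set by blast
    show "A \<in> carrier_mat (2 ^ n) (2 ^ n)" "hermitian_mat A" "op_norm A \<le> 2"
      by (simp_all add: A hermitian_ising_term op_norm_ising_term)
    have "card (support_op n A) \<le> card {u, v}"
      unfolding A by (rule card_mono[OF _ support_ising_term]) simp
    then show "card (support_op n A) \<le> 2"
      by (rule order.trans) (simp add: card_insert_if)
  next
    fix n q :: nat
    have "length (filter (\<lambda>A. q \<in> support_op n A) (T n))
        \<le> length (filter (\<lambda>(u, v). q = u \<or> q = v) (graph_edges (ps n) n))"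
      unfolding T_def ising_terms_def filter_map length_map
      by (rule length_filter_mono) (use support_ising_term in auto)
    also have "\<dots> \<le> 2 * length (ps n)" by (rule length_incident_edges_le[OF perm])
    finally show "length (filter (\<lambda>A. q \<in> support_op n A) (T n)) \<le> 30" by (simp add: len)
  qed
  moreover have "Z2_symmetric_hamiltonian n (T n)" for n
    unfolding Z2_symmetric_hamiltonian_def using T_set Z2_symmetric_ising_term by blast
  moreover have "ground_state_energy (sum_mats n (T n)) = 0" for n
    unfolding T_def sum_ising_terms
    by (rule ground_state_energy_mat_diag) (auto simp: cut_energy_nonneg, simp add: cut_energy_def spin_def split_def)
  moreover have "1/16 * real n < expectation (mat_adjoint U * sum_mats n (T n) * U) \<phi>"
    if n: "n \<in> {2..}" and d: "2 powr (3 * real d) \<le> real n"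
      and U: "is_circuit n d U" "Z2_symmetric_op n U" and \<phi>: "is_product_state n \<phi>" "Z2_symmetric_state n \<phi>"
    for n d U \<phi>
  proof -
    note bound = circuit_magnetization_bound[OF U \<phi>]
    note c\<phi> = is_product_state_carrier[OF \<phi>(1)]
    have c\<psi>: "U *\<^sub>v \<phi> \<in> carrier_vec (2 ^ n)" using bound(1) c\<phi> by simp
    have n0: "real n > 0" using n by simp
    define w where "w i = (cmod ((U *\<^sub>v \<phi>) $ i))\<^sup>2" for i
    \<comment> \<open>\<open>1/16\<close> is what remains of \<open>(n - 4 ^ d) / 4\<close> when
      \<open>4 ^ d\<close> is below \<open>3 * n / 4\<close>.\<close>
    have "1/16 * real n < (real n - 4 ^ d) / 4"
      using shallow_size_bound[of n d] n d by (simp add: field_simps)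
    also have "\<dots> = (real n ^ 2 * 1 - real n * 4 ^ d) / (4 * real n)"
      using n0 by (simp add: field_simps power2_eq_square)
    \<comment> \<open>Since the weights \<open>w i\<close> sum to \<open>1\<close>, the constant
      \<open>n^2\<close> is spread over the basis states, so that the energy bound applies to each
      of them.\<close>
    also have "\<dots> \<le> (real n ^ 2 * (\<Sum>i<2 ^ n. w i) - (\<Sum>i<2 ^ n. (\<Sum>u<n. spin i u)\<^sup>2 * w i)) / (4 * real n)"
      using bound(2,3) n0 unfolding w_def by (intro divide_right_mono diff_mono) auto
    also have "\<dots> = (\<Sum>i<2 ^ n. (real n ^ 2 - (\<Sum>u<n. spin i u)\<^sup>2) / (4 * real n) * w i)"
      by (simp add: sum_divide_distrib sum_subtractf sum_distrib_left left_diff_distrib diff_divide_distrib)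
    also have "\<dots> \<le> (\<Sum>i<2 ^ n. cut_energy (ps n) n i * w i)"
      by (intro sum_mono mult_right_mono cut_energy_ge_magnetization exp) (use n in \<open>auto simp: w_def\<close>)
    also have "\<dots> = expectation (mat_adjoint U * sum_mats n (T n) * U) \<phi>"
      unfolding expectation_def T_def sum_ising_terms expectation_conjugate[OF mat_diag_dim bound(1) c\<phi>]
        cscalar_prod_mat_diag[OF c\<psi>] Re_complex_of_real w_def ..
    finally show ?thesis .
  qed
  moreover have "infinite {2::nat..}" by (rule infinite_Ici)
  ultimately show ?thesis
    by (intro exI[of _ "1/16"] exI[of _ "3::real"] exI[of _ "{2..}"] exI[of _ T]) auto
qed

end
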